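(* (1) Let $p_1,\dots,p_6$ be distinct primes with $p_i\le 19$ for $i=1,\dots,6$. Then every solution in non-negative integers $\alpha_1,\dots,\alpha_6$ of $$p_1^{\alpha_1}p_2^{\alpha_2}+p_3^{\alpha_3}p_4^{\alpha_4}-p_5^{\alpha_5}p_6^{\alpha_6}=1$$ satisfies $\min_{1\le i\le 6}\alpha_i\le 5$. (2) The equation $$2^{\alpha_1}3^{\alpha_2}+5^{\alpha_3}7^{\alpha_4}-11^{\alpha_5}13^{\alpha_6}=1$$ has exactly two solutions in non-negative integers $\alpha_1,\dots,\alpha_6$, namely $(\alpha_1,\dots,\alpha_6)=(0,0,0,0,0,0)$ and $(0,2,1,0,0,1)$. *)

theory Defs
  imports "HOL-Computational_Algebra.Primes"
begin

end

theory Submission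
  imports Defs "HOL-Number_Theory.Cong"
begin

text \<open>
  Parity excludes the prime 2, so the theorem is a finite list of equations \<open>X + Y = Z + 1\<close> in which
  each term is a product of two powers of odd primes.  Each equation is refuted by reducing it
  successively modulo a list of prime powers \<open>q\<close>.  A modulus that divides a term kills that term
  (this is where the lower bounds on the exponents enter), and the residue of any other term \<open>p\<^sup>a p'\<^sup>b\<close>
  modulo \<open>q\<close> depends only on the class of \<open>(a, b)\<close> modulo the lattice of relations between the
  discrete logarithms of \<open>p\<close> and \<open>p'\<close>.  Intersecting these lattices one modulus at a time gives a
  search tree whose nodes are triples of classes; branches on which \<open>X + Y = Z + 1\<close> fails modulo
  \<open>q\<close> are cut, and for a suitable list of moduli nothing survives.

  All moduli used have a unit group whose exponent divides \<open>7920 = 16 \<cdot> 9 \<cdot> 5 \<cdot> 11\<close>.  The factor 11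
  serves to exclude the equations that do have solutions with small positive exponents, such as
  \<open>5\<^sup>2 \<cdot> 17 + 11 \<cdot> 13 = 3\<^sup>4 \<cdot> 7 + 1\<close>.
\<close>

section \<open>Exponent pairs and discrete logarithms\<close>

text \<open>Modular addition and multiplication get names of their own so that the evaluated search
  can rewrite them by precomputed tables instead of computing with \<open>mod\<close>.\<close>

definition madd :: "int \<Rightarrow> int \<Rightarrow> int \<Rightarrow> int" where
  "madd m x y = (x + y) mod m"

definition mmul :: "int \<Rightarrow> int \<Rightarrow> int \<Rightarrow> int" where
  "mmul m x y = (x * y) mod m"

text \<open>
  A pair of exponents is stored through its residues modulo 16, 9, 5 and 11, which keeps all
  arithmetic of the search within small lookup tables.
\<close>

datatype digits = Digits int int int int int int int int

definition digits_of :: "int \<Rightarrow> int \<Rightarrow> digits" where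
  "digits_of a b = Digits (a mod 16) (b mod 16) (a mod 9) (b mod 9) (a mod 5) (b mod 5) (a mod 11) (b mod 11)"

fun shift :: "digits \<Rightarrow> digits \<Rightarrow> digits" where
  "shift (Digits a1 b1 a2 b2 a3 b3 a4 b4) (Digits c1 d1 c2 d2 c3 d3 c4 d4) =
     Digits (madd 16 a1 c1) (madd 16 b1 d1) (madd 9 a2 c2) (madd 9 b2 d2)
       (madd 5 a3 c3) (madd 5 b3 d3) (madd 11 a4 c4) (madd 11 b4 d4)"

lemma shift_digits_of: "shift (digits_of a b) (digits_of c d) = digits_of (a + c) (b + d)"
  by (simp add: digits_of_def madd_def mod_simps)

text \<open>A slot \<open>(m, c, d)\<close> stands for the linear form \<open>c a + d b\<close> modulo \<open>m\<close>.\<close>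

type_synonym slot = "int \<times> int \<times> int"

fun slot_log :: "slot \<Rightarrow> digits \<Rightarrow> int" where
  "slot_log (m, c, d) (Digits a1 b1 a2 b2 a3 b3 a4 b4) =
     (if m dvd 16 then madd m (mmul m c a1) (mmul m d b1)
      else if m dvd 9 then madd m (mmul m c a2) (mmul m d b2)
      else if m dvd 5 then madd m (mmul m c a3) (mmul m d b3)
      else madd m (mmul m c a4) (mmul m d b4))"

definition slot_modulus :: "int \<Rightarrow> bool" where
  "slot_modulus m \<longleftrightarrow> 0 < m \<and> (m dvd 16 \<or> m dvd 9 \<or> m dvd 5 \<or> m dvd 11)"

text \<open>Reducing \<open>a\<close> and \<open>b\<close> modulo \<open>M\<close> does not change a
  linear form modulo a divisor of \<open>M\<close>, so one digit pair serves all orders dividing 16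
  (likewise 9, 5, 11). The last branch of \<open>slot_log\<close> is the order 11, the only
  remaining possibility under \<open>slot_modulus\<close>.\<close>

lemma slot_log_digits_of:
  assumes "slot_modulus m"
  shows "slot_log (m, c, d) (digits_of a b) = (c * a + d * b) mod m"
proof -
  have *: "((c * (a mod M)) mod m + (d * (b mod M)) mod m) mod m = (c * a + d * b) mod m"
    if "m dvd M" for M
  proof -
    have "(c * (x mod M)) mod m = (c * x) mod m" for c x
      using that by (metis mod_mod_cancel mod_mult_right_eq)
    then show ?thesis
      by (simp add: mod_simps)
  qed
  show ?thesis
    using assms by (auto simp: slot_modulus_def digits_of_def madd_def mmul_def *)
qed

text \<open>The eight orders that occur in \<open>unit_table\<close>, one equation each, so that no
  \<open>if\<close> is left to evaluate during the search.\<close>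

lemma slot_log_simps:
  "slot_log (2, c, d) (Digits a1 b1 a2 b2 a3 b3 a4 b4) = madd 2 (mmul 2 c a1) (mmul 2 d b1)"
  "slot_log (4, c, d) (Digits a1 b1 a2 b2 a3 b3 a4 b4) = madd 4 (mmul 4 c a1) (mmul 4 d b1)"
  "slot_log (8, c, d) (Digits a1 b1 a2 b2 a3 b3 a4 b4) = madd 8 (mmul 8 c a1) (mmul 8 d b1)"
  "slot_log (16, c, d) (Digits a1 b1 a2 b2 a3 b3 a4 b4) = madd 16 (mmul 16 c a1) (mmul 16 d b1)"
  "slot_log (3, c, d) (Digits a1 b1 a2 b2 a3 b3 a4 b4) = madd 3 (mmul 3 c a2) (mmul 3 d b2)"
  "slot_log (9, c, d) (Digits a1 b1 a2 b2 a3 b3 a4 b4) = madd 9 (mmul 9 c a2) (mmul 9 d b2)"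
  "slot_log (5, c, d) (Digits a1 b1 a2 b2 a3 b3 a4 b4) = madd 5 (mmul 5 c a3) (mmul 5 d b3)"
  "slot_log (11, c, d) (Digits a1 b1 a2 b2 a3 b3 a4 b4) = madd 11 (mmul 11 c a4) (mmul 11 d b4)"
  by simp_all

fun slot_logs :: "slot list \<Rightarrow> digits \<Rightarrow> int list" where
  "slot_logs [] v = []"
| "slot_logs (s # ss) v = slot_log s v # slot_logs ss v"

text \<open>For the slots built from the logarithms of \<open>p\<close> and \<open>p'\<close>, this
  is the discrete logarithm of \<open>p ^ a * p' ^ b\<close>, one coordinate per generator.\<close>

definition log_vector :: "slot list \<Rightarrow> int \<Rightarrow> int \<Rightarrow> int list" where
  "log_vector ss a b = map (\<lambda>(m, c, d). (c * a + d * b) mod m) ss"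

fun add_logs :: "slot list \<Rightarrow> int list \<Rightarrow> int list \<Rightarrow> int list" where
  "add_logs ((m, c, d) # ss) (l # ls) (k # ks) = madd m l k # add_logs ss ls ks"
| "add_logs _ _ _ = []"

lemma add_logs_log_vector:
  "add_logs ss (log_vector ss a b) (log_vector ss h h') = log_vector ss (a + h) (b + h')"
proof -
  have "((c * a + d * b) mod m + (c * h + d * h') mod m) mod m = (c * (a + h) + d * (b + h')) mod m" for m c d
    unfolding mod_add_eq by (simp add: algebra_simps)
  then show ?thesis
    by (induction ss) (auto simp: log_vector_def madd_def)
qed

lemma slot_logs_digits_of:
  "\<forall>(m, c, d) \<in> set ss. slot_modulus m \<Longrightarrow> slot_logs ss (digits_of a b) = log_vector ss a b"
  by (induction ss) (auto simp: log_vector_def slot_log_digits_of simp del: slot_log.simps)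

text \<open>
  Each entry \<open>(q, gs, ls)\<close> lists generators \<open>g\<close> of the unit group modulo \<open>q\<close> with their orders \<open>m\<close>
  as pairs \<open>(m, g)\<close>, and for each prime \<open>p\<close> the exponents with which \<open>p\<close> is a product of these
  generators.  The base 1 stands for an absent prime.
\<close>

definition unit_table :: "(int \<times> (int \<times> int) list \<times> (int \<times> int list) list) list" where
  "unit_table =
  [(3, [(2, 2)],
     [(1, [0]), (5, [1]), (7, [0]), (11, [1]), (13, [0]), (17, [1]), (19, [0])]),
   (4, [(2, 3)],
     [(1, [0]), (3, [1]), (5, [0]), (7, [1]), (11, [1]), (13, [0]), (17, [0]), (19, [1])]),
   (8, [(2, 7), (2, 5)],
     [(1, [0, 0]), (3, [1, 1]), (5, [0, 1]), (7, [1, 0]), (11, [1, 1]), (13, [0, 1]), (17, [0, 0]),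
      (19, [1, 1])]),
   (5, [(4, 2)],
     [(1, [0]), (3, [3]), (7, [1]), (11, [0]), (13, [3]), (17, [1]), (19, [2])]),
   (7, [(2, 6), (3, 2)],
     [(1, [0, 0]), (3, [1, 2]), (5, [1, 1]), (11, [0, 2]), (13, [1, 0]), (17, [1, 2]), (19, [1, 1])]),
   (13, [(4, 8), (3, 3)],
     [(1, [0, 0]), (3, [0, 1]), (5, [3, 0]), (7, [1, 2]), (11, [1, 1]), (17, [2, 2]), (19, [3, 2])]),
   (9, [(2, 8), (3, 4)],
     [(1, [0, 0]), (5, [1, 1]), (7, [0, 2]), (11, [1, 2]), (13, [0, 1]), (17, [1, 0]), (19, [0, 0])]),
   (19, [(2, 18), (9, 4)],
     [(1, [0, 0]), (3, [1, 2]), (5, [0, 8]), (7, [0, 3]), (11, [0, 6]), (13, [1, 7]), (17, [0, 5])]),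
   (16, [(2, 15), (4, 5)],
     [(1, [0, 0]), (3, [1, 3]), (5, [0, 1]), (7, [1, 2]), (11, [1, 1]), (13, [0, 3]), (17, [0, 0]),
      (19, [1, 3])]),
   (37, [(4, 31), (9, 16)],
     [(1, [0, 0]), (3, [2, 2]), (5, [3, 8]), (7, [0, 8]), (11, [2, 3]), (13, [3, 5]), (17, [3, 4]),
      (19, [3, 2])]),
   (27, [(2, 26), (9, 4)],
     [(1, [0, 0]), (5, [1, 7]), (7, [0, 8]), (11, [1, 2]), (13, [0, 4]), (17, [1, 3]), (19, [0, 6])]),
   (73, [(8, 10), (9, 2)],
     [(1, [0, 0]), (3, [6, 3]), (5, [1, 8]), (7, [1, 3]), (11, [7, 8]), (13, [3, 4]), (17, [5, 6]),
      (19, [6, 1])]),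
   (17, [(16, 3)],
     [(1, [0]), (3, [1]), (5, [5]), (7, [11]), (11, [7]), (13, [4]), (19, [14])]),
   (181, [(4, 162), (9, 43), (5, 59)],
     [(1, [0, 0, 0]), (3, [0, 1, 1]), (5, [0, 6, 1]), (7, [3, 3, 0]), (11, [2, 4, 2]),
      (13, [0, 1, 4]), (17, [3, 2, 0]), (19, [3, 0, 0])]),
   (11, [(2, 10), (5, 4)],
     [(1, [0, 0]), (3, [0, 4]), (5, [0, 2]), (7, [1, 1]), (13, [1, 3]), (17, [1, 2]), (19, [1, 4])]),
   (61, [(4, 11), (3, 47), (5, 9)],
     [(1, [0, 0, 0]), (3, [2, 0, 3]), (5, [2, 2, 1]), (7, [3, 2, 2]), (11, [1, 0, 0]),
      (13, [0, 2, 0]), (17, [1, 1, 1]), (19, [2, 1, 3])]),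
   (41, [(8, 27), (5, 10)],
     [(1, [0, 0]), (3, [3, 0]), (5, [6, 4]), (7, [3, 3]), (11, [7, 1]), (13, [3, 2]), (17, [5, 1]),
      (19, [5, 3])]),
   (25, [(4, 7), (5, 16)],
     [(1, [0, 0]), (3, [3, 3]), (7, [1, 0]), (11, [0, 4]), (13, [3, 1]), (17, [1, 2]), (19, [2, 2])]),
   (241, [(16, 111), (3, 15), (5, 91)],
     [(1, [0, 0, 0]), (3, [10, 1, 4]), (5, [6, 0, 1]), (7, [15, 2, 2]), (11, [7, 2, 0]),
      (13, [1, 1, 4]), (17, [1, 0, 2]), (19, [11, 2, 0])]),
   (32, [(2, 31), (8, 5)],
     [(1, [0, 0]), (3, [1, 3]), (5, [0, 1]), (7, [1, 2]), (11, [1, 5]), (13, [0, 7]), (17, [0, 4]),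
      (19, [1, 7])]),
   (199, [(2, 198), (9, 175), (11, 125)],
     [(1, [0, 0, 0]), (3, [1, 7, 8]), (5, [0, 3, 4]), (7, [0, 4, 3]), (11, [1, 0, 5]),
      (13, [0, 7, 1]), (17, [1, 6, 5]), (19, [1, 7, 0])]),
   (121, [(2, 120), (5, 81), (11, 56)],
     [(1, [0, 0, 0]), (3, [0, 4, 0]), (5, [0, 2, 3]), (7, [1, 1, 4]), (13, [1, 3, 9]),
      (17, [1, 2, 6]), (19, [1, 4, 5])]),
   (89, [(8, 37), (11, 64)],
     [(1, [0, 0]), (3, [3, 7]), (5, [2, 6]), (7, [3, 6]), (11, [4, 5]), (13, [5, 7]), (17, [2, 9]),
      (19, [1, 3])]),
   (23, [(2, 22), (11, 2)],
     [(1, [0, 0]), (3, [0, 8]), (5, [1, 6]), (7, [1, 4]), (11, [1, 10]), (13, [0, 7]), (17, [1, 9]),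
      (19, [1, 2])])]"

section \<open>Residues of \<open>p ^ a * p' ^ b\<close> from discrete logarithms\<close>

definition gens :: "int \<Rightarrow> (int \<times> int) list" where
  "gens q = fst (the (map_of unit_table q))"

definition logs :: "int \<Rightarrow> int \<Rightarrow> int list" where
  "logs q p = the (map_of (snd (the (map_of unit_table q))) p)"

fun gens_prod :: "(int \<times> int) list \<Rightarrow> int list \<Rightarrow> int" where
  "gens_prod ((m, g) # gs) (l # ls) = g ^ nat l * gens_prod gs ls"
| "gens_prod _ _ = 1"

definition unit_of_logs :: "int \<Rightarrow> int list \<Rightarrow> int" where
  "unit_of_logs q ls = gens_prod (gens q) ls mod q"

fun slots :: "(int \<times> int) list \<Rightarrow> int list \<Rightarrow> int list \<Rightarrow> slot list" where
  "slots ((m, g) # gs) (c # cs) (d # ds) = (m, c, d) # slots gs cs ds"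
| "slots _ _ _ = []"

definition ok_gens :: "int \<Rightarrow> bool" where
  "ok_gens q \<longleftrightarrow> list_all (\<lambda>(m, g). slot_modulus m \<and> g ^ nat m mod q = 1) (gens q)"

text \<open>Nonnegativity matters because \<open>gens_prod\<close> turns logarithms into exponents
  with \<open>nat\<close>, which sends negative numbers to 0.\<close>

definition ok_logs :: "int \<Rightarrow> int \<Rightarrow> bool" where
  "ok_logs q p \<longleftrightarrow> length (logs q p) = length (gens q) \<and> list_all (\<lambda>c. 0 \<le> c) (logs q p)
     \<and> gens_prod (gens q) (logs q p) mod q = p mod q"

lemma cong_power_mod_order:
  fixes g q m l :: int
  assumes "[g ^ nat m = 1] (mod q)" "0 < m" "0 \<le> l"
  shows "[g ^ nat (l mod m) = g ^ nat l] (mod q)"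
proof -
  have "nat l = nat m * nat (l div m) + nat (l mod m)"
    using assms by (simp flip: nat_mult_distrib nat_add_distrib add: pos_imp_zdiv_nonneg_iff)
  then have "g ^ nat l = (g ^ nat m) ^ nat (l div m) * g ^ nat (l mod m)"
    by (simp add: power_add power_mult)
  moreover have "[(g ^ nat m) ^ nat (l div m) * g ^ nat (l mod m) = 1 ^ nat (l div m) * g ^ nat (l mod m)] (mod q)"
    using assms(1) by (intro cong_mult cong_pow cong_refl)
  ultimately show ?thesis
    by (simp add: cong_sym)
qed

text \<open>Generator by generator: \<open>g\<close> occurs on the right with exponent
  \<open>c * a + d * b\<close>, which may be reduced modulo \<open>m\<close> because
  \<open>g ^ nat m\<close> is 1 modulo \<open>q\<close>.\<close>

lemma gens_prod_cong_power:
  assumes "\<forall>(m, g) \<in> set gs. slot_modulus m \<and> [g ^ nat m = 1] (mod q)"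
    and "length cs = length gs" "length ds = length gs"
    and "\<forall>c \<in> set cs. 0 \<le> c" "\<forall>d \<in> set ds. 0 \<le> d"
  shows "[gens_prod gs (log_vector (slots gs cs ds) (int a) (int b)) =
           gens_prod gs cs ^ a * gens_prod gs ds ^ b] (mod q)"
  using assms
proof (induction gs cs ds rule: slots.induct)
  case (1 m g gs c cs d ds)
  have nn: "0 \<le> c" "0 \<le> d" and m: "0 < m" "[g ^ nat m = 1] (mod q)"
    using "1.prems" by (auto simp: slot_modulus_def)
  have "nat (c * int a + d * int b) = nat c * a + nat d * b"
    using nn by (simp add: nat_add_distrib nat_mult_distrib)
  then have "g ^ nat (c * int a + d * int b) = (g ^ nat c) ^ a * (g ^ nat d) ^ b"
    by (simp add: power_add power_mult)
  then have "[g ^ nat ((c * int a + d * int b) mod m) = (g ^ nat c) ^ a * (g ^ nat d) ^ b] (mod q)"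
    using cong_power_mod_order[OF m(2,1), of "c * int a + d * int b"] nn by simp
  moreover have "[gens_prod gs (log_vector (slots gs cs ds) (int a) (int b)) =
           gens_prod gs cs ^ a * gens_prod gs ds ^ b] (mod q)"
    using 1 by simp
  ultimately have "[g ^ nat ((c * int a + d * int b) mod m) * gens_prod gs (log_vector (slots gs cs ds) (int a) (int b)) =
      ((g ^ nat c) ^ a * (g ^ nat d) ^ b) * (gens_prod gs cs ^ a * gens_prod gs ds ^ b)] (mod q)"
    by (rule cong_mult)
  then show ?case
    by (simp add: log_vector_def power_mult_distrib mult_ac)
qed auto

text \<open>This makes the search finite: the residue of a term depends on its exponents only
  through finitely many logarithm values.\<close>

lemma power_product_mod:
  assumes "ok_gens q" "ok_logs q p" "ok_logs q p'" "1 < q"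
  shows "p ^ a * p' ^ b mod q =
    unit_of_logs q (log_vector (slots (gens q) (logs q p) (logs q p')) (int a) (int b))"
proof -
  have "[gens_prod (gens q) (log_vector (slots (gens q) (logs q p) (logs q p')) (int a) (int b)) =
          gens_prod (gens q) (logs q p) ^ a * gens_prod (gens q) (logs q p') ^ b] (mod q)"
    using assms by (intro gens_prod_cong_power) (auto simp: ok_gens_def ok_logs_def list_all_iff cong_def)
  also have "[gens_prod (gens q) (logs q p) ^ a * gens_prod (gens q) (logs q p') ^ b = p ^ a * p' ^ b] (mod q)"
    using assms by (intro cong_mult cong_pow) (auto simp: ok_logs_def cong_def)
  finally show ?thesis
    by (simp add: unit_of_logs_def cong_def)
qed

section \<open>Lattices of exponent pairs\<close>

type_synonym hnf = "int \<times> int \<times> int"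

text \<open>The triple \<open>(n, s, n')\<close> encodes the lattice spanned by \<open>(n, 0)\<close> and \<open>(s, n')\<close>.\<close>

definition lattice :: "hnf \<Rightarrow> (int \<times> int) set" where
  "lattice H = (case H of (n, s, n') \<Rightarrow> {(i * n + j * s, j * n') | i j. True})"

text \<open>Executable membership test: the second coordinate forces the coefficient
  \<open>u' div n'\<close> of \<open>(s, n')\<close>, and what remains must be a multiple of
  \<open>n\<close>. For \<open>n = 0\<close> the divisibility becomes an equality; this case serves
  later to fix an exponent.\<close>

fun mem_lattice :: "hnf \<Rightarrow> int \<Rightarrow> int \<Rightarrow> bool" where
  "mem_lattice (n, s, n') u u' \<longleftrightarrow> u' div n' * n' = u' \<and> n dvd u - u' div n' * s"

lemma mem_latticeD:
  assumes "mem_lattice H u u'"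
  shows "(u, u') \<in> lattice H"
proof -
  obtain n s n' where H: "H = (n, s, n')"
    by (cases H)
  with assms obtain i where "u - u' div n' * s = n * i" "u' div n' * n' = u'"
    by (auto elim: dvdE)
  then have "(u, u') = (i * n + (u' div n') * s, (u' div n') * n')"
    by (simp add: algebra_simps)
  then show ?thesis
    unfolding lattice_def H by blast
qed

lemma lattice_add: "(u, u') \<in> lattice H \<Longrightarrow> (w, w') \<in> lattice H \<Longrightarrow> (u + w, u' + w') \<in> lattice H"
proof (cases H)
  fix n s n'
  assume H: "H = (n, s, n')" and "(u, u') \<in> lattice H" "(w, w') \<in> lattice H"
  then obtain i j k l where "u = i * n + j * s" "u' = j * n'" "w = k * n + l * s" "w' = l * n'"
    by (auto simp: lattice_def)
  then have "u + w = (i + k) * n + (j + l) * s" "u' + w' = (j + l) * n'"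
    by (simp_all add: algebra_simps)
  then show ?thesis
    unfolding lattice_def H by blast
qed

lemma lattice_scale: "(u, u') \<in> lattice H \<Longrightarrow> (t * u, t * u') \<in> lattice H"
proof (cases H)
  fix n s n'
  assume H: "H = (n, s, n')" and "(u, u') \<in> lattice H"
  then obtain i j where "u = i * n + j * s" "u' = j * n'"
    by (auto simp: lattice_def)
  then have "t * u = (t * i) * n + (t * j) * s" "t * u' = (t * j) * n'"
    by (simp_all add: algebra_simps)
  then show ?thesis
    unfolding lattice_def H by blast
qed

lemma lattice_full: "(u, u') \<in> lattice (1, 0, 1)"
  by (simp add: lattice_def)

text \<open>A linear form that vanishes modulo \<open>m\<close> on both basis vectors vanishes on
  the whole lattice, so it is constant on each class.\<close>

lemma log_vector_cong_lattice:
  assumes "\<forall>(m, c, d) \<in> set ss. m dvd c * n \<and> m dvd c * s + d * n'"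
    and "(a - v, b - w) \<in> lattice (n, s, n')"
  shows "log_vector ss a b = log_vector ss v w"
proof -
  obtain i j where ij: "a - v = i * n + j * s" "b - w = j * n'"
    using assms(2) by (auto simp: lattice_def)
  have "(c * a + d * b) mod m = (c * v + d * w) mod m" if "(m, c, d) \<in> set ss" for m c d
  proof -
    have "(c * a + d * b) - (c * v + d * w) = i * (c * n) + j * (c * s + d * n')"
    proof -
      have "(c * a + d * b) - (c * v + d * w) = c * (a - v) + d * (b - w)"
        by (simp add: algebra_simps)
      then show ?thesis
        by (simp add: ij algebra_simps)
    qed
    moreover have "m dvd c * n" "m dvd c * s + d * n'"
      using assms(1) that by auto
    ultimately have "m dvd (c * a + d * b) - (c * v + d * w)"
      by simp
    then show ?thesis
      by (simp add: mod_eq_dvd_iff)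
  qed
  then show ?thesis
    by (auto simp: log_vector_def)
qed

section \<open>The search\<close>

text \<open>
  A \<open>Logs\<close> step enumerates the residues of a term modulo \<open>q\<close> that are compatible with what is known
  about its exponents: its slots, the logarithms of a vector \<open>h\<close>, and the digits of
  \<open>0, h, 2 h, \<dots>\<close>, which represent the classes of the next lattice in the current one.
\<close>

datatype step = Zero | Logs "slot list" "int list" "digits list"

text \<open>The logarithms along the multiples of \<open>h\<close> arise by repeatedly adding
  \<open>ks\<close>, so the linear forms are evaluated only at the starting pair. The digits stored
  with a residue are the displacement from the node, not the new position.\<close>

fun coset :: "int \<Rightarrow> slot list \<Rightarrow> int list \<Rightarrow> int list \<Rightarrow> digits list \<Rightarrow> (int \<times> digits) list" where
  "coset q ss ls ks [] = []"
| "coset q ss ls ks (h # hs) = (unit_of_logs q ls, h) # coset q ss (add_logs ss ls ks) ks hs"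

fun children :: "int \<Rightarrow> step \<Rightarrow> digits \<Rightarrow> (int \<times> digits) list" where
  "children q Zero v = [(0, Digits 0 0 0 0 0 0 0 0)]"
| "children q (Logs ss ks hs) v = coset q ss (slot_logs ss v) ks hs"

definition pred_mod :: "int \<Rightarrow> int \<Rightarrow> int" where
  "pred_mod q s = (s - 1) mod q"

type_synonym search = "(int \<times> step \<times> step \<times> step) list"

text \<open>The empty list yields \<open>False\<close> because a branch that survives every modulus
  refutes nothing.\<close>

primrec exhausts :: "search \<Rightarrow> digits \<Rightarrow> digits \<Rightarrow> digits \<Rightarrow> bool" where
  "exhausts [] x y z = False"
| "exhausts (p # ps) x y z = (case p of (q, sx, sy, sz) \<Rightarrow>
     (\<forall>(rx, hx) \<in> set (children q sx x). \<forall>(ry, hy) \<in> set (children q sy y).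
      \<forall>(rz, hz) \<in> set (children q sz z).
        pred_mod q (rx + ry) = rz \<longrightarrow> exhausts ps (shift x hx) (shift y hy) (shift z hz)))"

fun search :: "int list \<Rightarrow> step list \<Rightarrow> step list \<Rightarrow> step list \<Rightarrow> search" where
  "search (q # qs) (a # as) (b # bs) (c # cs) = (q, a, b, c) # search qs as bs cs"
| "search _ _ _ _ = []"

text \<open>Follows a single number \<open>X\<close> through its own steps. This separates the three
  terms: each is analysed alone, and they meet only in \<open>exhausts_sound\<close>.\<close>

fun feasible :: "int list \<Rightarrow> step list \<Rightarrow> digits \<Rightarrow> int \<Rightarrow> bool" where
  "feasible (q # qs) (s # ss) v X \<longleftrightarrow> (\<exists>h. (X mod q, h) \<in> set (children q s v) \<and> feasible qs ss (shift v h) X)"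
| "feasible [] [] v X \<longleftrightarrow> True"
| "feasible _ _ v X \<longleftrightarrow> False"

text \<open>A solution would select at each modulus a triple of children that passes the test, hence
  a branch reaching the empty list, where \<open>exhausts\<close> is false.\<close>

lemma exhausts_sound:
  assumes "exhausts (search qs sx sy sz) x y z"
    and "feasible qs sx x X" "feasible qs sy y Y" "feasible qs sz z Z"
  shows "X + Y \<noteq> Z + 1"
  using assms
proof (induction qs arbitrary: sx sy sz x y z)
  case Nil
  then show ?case
    by simp
next
  case (Cons q qs)
  \<comment> \<open>\<open>feasible\<close> fails for lists of different length, so all three step
    lists are nonempty.\<close>
  from Cons.prems(2-4) obtain a sx' b sy' c sz' where s: "sx = a # sx'" "sy = b # sy'" "sz = c # sz'"
    by (cases sx; cases sy; cases sz) auto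
  with Cons.prems obtain hx hy hz where
    h: "(X mod q, hx) \<in> set (children q a x)" "feasible qs sx' (shift x hx) X"
       "(Y mod q, hy) \<in> set (children q b y)" "feasible qs sy' (shift y hy) Y"
       "(Z mod q, hz) \<in> set (children q c z)" "feasible qs sz' (shift z hz) Z"
    by auto
  show ?case
  proof
    assume eq: "X + Y = Z + 1"
    have "pred_mod q (X mod q + Y mod q) = (X + Y - 1) mod q"
      by (metis pred_mod_def mod_add_eq mod_diff_left_eq)
    also have "\<dots> = Z mod q"
      using eq by simp
    finally have "exhausts (search qs sx' sy' sz') (shift x hx) (shift y hy) (shift z hz)"
      using Cons.prems(1) h unfolding s by (fastforce simp del: children.simps)
    then show False
      using Cons.IH h eq by blast
  qed
qed

section \<open>Certificates\<close>

text \<open>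
  \<open>Refine r h h' n s n' k k'\<close> passes from the current lattice to the one with basis \<open>(n, s, n')\<close>,
  whose classes in the current one are represented by \<open>0, \<dots>, (r - 1) (h, h')\<close>; the numbers \<open>k\<close>, \<open>k'\<close>
  are the multiples of \<open>(h, h')\<close> representing the classes of the two current basis vectors.
\<close>

datatype cert = Vanish | Refine int int int int int int int int

fun compile :: "int \<Rightarrow> int \<Rightarrow> int list \<Rightarrow> cert list \<Rightarrow> step list" where
  "compile p p' (q # qs) (Vanish # cs) = Zero # compile p p' qs cs"
| "compile p p' (q # qs) (Refine r h h' n s n' k k' # cs) =
     (let ss = slots (gens q) (logs q p) (logs q p') in
      Logs ss (log_vector ss h h') (map (\<lambda>i. digits_of (i * h) (i * h')) [0..r - 1])) # compile p p' qs cs"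
| "compile p p' _ _ = []"

text \<open>Modulo \<open>H'\<close> the current basis vectors are congruent to \<open>k\<close> and
  \<open>k'\<close> times \<open>(h, h')\<close>, and \<open>r\<close> times \<open>(h, h')\<close>
  is congruent to 0. Hence the multiples of \<open>(h, h')\<close> by 0 up to \<open>r - 1\<close>
  meet every class of \<open>H\<close> modulo \<open>H'\<close>. The condition on \<open>ss\<close>
  puts \<open>H'\<close> into the kernel of the logarithm map.\<close>

definition ok_refine :: "hnf \<Rightarrow> slot list \<Rightarrow> int \<Rightarrow> int \<Rightarrow> int \<Rightarrow> hnf \<Rightarrow> int \<Rightarrow> int \<Rightarrow> bool" where
  "ok_refine H ss r h h' H' k k' \<longleftrightarrow> (case (H, H') of ((n0, s0, n0'), (n, s, n')) \<Rightarrow>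
     0 < r \<and> list_all (\<lambda>(m, c, d). (c * n) mod m = 0 \<and> (c * s + d * n') mod m = 0) ss
     \<and> mem_lattice H' (n0 - k * h) (- (k * h')) \<and> mem_lattice H' (s0 - k' * h) (n0' - k' * h')
     \<and> mem_lattice H' (r * h) (r * h'))"

text \<open>\<open>d\<close> is a known divisor of the term \<open>p ^ a * p' ^ b\<close>. A modulus
  may be declared vanishing only if it divides \<open>d\<close>, and the lattice then stays the
  same.\<close>

fun valid :: "int \<Rightarrow> int \<Rightarrow> int \<Rightarrow> hnf \<Rightarrow> int list \<Rightarrow> cert list \<Rightarrow> bool" where
  "valid d p p' H (q # qs) (Vanish # cs) \<longleftrightarrow> d mod q = 0 \<and> valid d p p' H qs cs"
| "valid d p p' H (q # qs) (Refine r h h' n s n' k k' # cs) \<longleftrightarrow>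
     1 < q \<and> ok_gens q \<and> ok_logs q p \<and> ok_logs q p'
     \<and> ok_refine H (slots (gens q) (logs q p) (logs q p')) r h h' (n, s, n') k k'
     \<and> valid d p p' (n, s, n') qs cs"
| "valid d p p' H [] [] \<longleftrightarrow> True"
| "valid d p p' H _ _ \<longleftrightarrow> False"

lemma coset_nth:
  "i < length hs \<Longrightarrow> (unit_of_logs q (log_vector ss (a + int i * h) (b + int i * h')), hs ! i)
     \<in> set (coset q ss (log_vector ss a b) (log_vector ss h h') hs)"
proof (induction hs arbitrary: a b i)
  case (Cons g hs)
  show ?case
  proof (cases i)
    case (Suc j)
    then have "(unit_of_logs q (log_vector ss (a + h + int j * h) (b + h' + int j * h')), hs ! j)
        \<in> set (coset q ss (log_vector ss (a + h) (b + h')) (log_vector ss h h') hs)"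
      using Cons by simp
    then show ?thesis
      using Suc by (simp add: add_logs_log_vector algebra_simps)
  qed simp
qed simp

lemma slots_slot_modulus:
  "\<forall>(m, g) \<in> set gs. slot_modulus m \<Longrightarrow> \<forall>(m, c, d) \<in> set (slots gs cs ds). slot_modulus m"
  by (induction gs cs ds rule: slots.induct) auto

lemma ok_refine_representative:
  assumes "ok_refine H ss r h h' H' k k'" "(u, u') \<in> lattice H"
  obtains i where "0 \<le> i" "i < r" "(u - i * h, u' - i * h') \<in> lattice H'"
proof -
  obtain n0 s0 n0' where H: "H = (n0, s0, n0')"
    by (cases H)
  have r: "0 < r" and L: "(n0 - k * h, - (k * h')) \<in> lattice H'"
    "(s0 - k' * h, n0' - k' * h') \<in> lattice H'" "(r * h, r * h') \<in> lattice H'"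
    using assms(1) unfolding ok_refine_def H by (auto intro: mem_latticeD split: prod.splits)
  obtain i j where ij: "u = i * n0 + j * s0" "u' = j * n0'"
    using assms(2) unfolding H by (auto simp: lattice_def)
  \<comment> \<open>The multiple of \<open>(h, h')\<close> congruent to \<open>(u, u')\<close>
    modulo \<open>H'\<close>, read off from the coordinates of \<open>(u, u')\<close> in the basis
    of \<open>H\<close>; its residue modulo \<open>r\<close> is the wanted index.\<close>
  define t where "t = i * k + j * k'"
  have t: "t = t div r * r + t mod r"
    by simp
  have "(i * (n0 - k * h) + j * (s0 - k' * h) + t div r * (r * h),
         i * (- (k * h')) + j * (n0' - k' * h') + t div r * (r * h')) \<in> lattice H'"
    by (rule lattice_add[OF lattice_add[OF lattice_scale[OF L(1)] lattice_scale[OF L(2)]] lattice_scale[OF L(3)]])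
  also have "i * (n0 - k * h) + j * (s0 - k' * h) + t div r * (r * h) = u - (t - t div r * r) * h"
    by (simp add: ij t_def algebra_simps)
  also have "i * (- (k * h')) + j * (n0' - k' * h') + t div r * (r * h') = u' - (t - t div r * r) * h'"
    by (simp add: ij t_def algebra_simps)
  also have "t - t div r * r = t mod r"
    by (simp add: minus_div_mult_eq_mod)
  finally show ?thesis
    using that[of "t mod r"] r by simp
qed

text \<open>Invariant along the path: \<open>(a, b)\<close> differs from the representative
  \<open>(v, w)\<close> reached so far by a vector of the current lattice. A \<open>Refine\<close>
  step moves the representative by \<open>i\<close> times \<open>(h, h')\<close>, with
  \<open>i\<close> from \<open>ok_refine_representative\<close>. In a \<open>Vanish\<close> step it
  stays in place and the residue is 0, as \<open>q\<close> divides \<open>d\<close> and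
  \<open>d\<close> divides the term.\<close>

lemma valid_feasible:
  assumes "valid d p p' H qs cs" "(int a - v, int b - w) \<in> lattice H" "d dvd p ^ a * p' ^ b"
  shows "feasible qs (compile p p' qs cs) (digits_of v w) (p ^ a * p' ^ b)"
  using assms
proof (induction qs arbitrary: cs H v w)
  case Nil
  then show ?case
    by (cases cs) auto
next
  case (Cons q qs)
  from Cons.prems(1) obtain c cs' where cs: "cs = c # cs'"
    by (cases cs) auto
  show ?case
  proof (cases c)
    case Vanish
    have "shift (digits_of v w) (Digits 0 0 0 0 0 0 0 0) = digits_of v w"
      using shift_digits_of[of v w 0 0] by (simp add: digits_of_def)
    moreover have "p ^ a * p' ^ b mod q = 0"
      using Cons.prems cs Vanish by (auto simp: mod_eq_0_iff_dvd intro: dvd_trans)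
    ultimately show ?thesis
      using Cons.IH[of H cs' v w] Cons.prems cs Vanish by simp
  next
    case (Refine r h h' n s n' k k')
    define ss where "ss = slots (gens q) (logs q p) (logs q p')"
    have q: "1 < q" "ok_gens q" "ok_logs q p" "ok_logs q p'"
      and ref: "ok_refine H ss r h h' (n, s, n') k k'" and val: "valid d p p' (n, s, n') qs cs'"
      using Cons.prems(1) cs Refine by (auto simp: ss_def)
    obtain i where i: "0 \<le> i" "i < r"
      "(int a - (v + i * h), int b - (w + i * h')) \<in> lattice (n, s, n')"
      using ok_refine_representative[OF ref Cons.prems(2)] by (metis diff_diff_eq)
    have m: "\<forall>(m, c, d) \<in> set ss. slot_modulus m"
      unfolding ss_def using q by (intro slots_slot_modulus) (auto simp: ok_gens_def list_all_iff)
    have "\<forall>(m, c, d) \<in> set ss. m dvd c * n \<and> m dvd c * s + d * n'"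
      using ref by (auto simp: ok_refine_def list_all_iff split: prod.splits)
    then have "p ^ a * p' ^ b mod q = unit_of_logs q (log_vector ss (v + i * h) (w + i * h'))"
      using power_product_mod[OF q(2-4,1)] log_vector_cong_lattice i(3) by (simp add: ss_def)
    moreover have "(unit_of_logs q (log_vector ss (v + i * h) (w + i * h')), digits_of (i * h) (i * h'))
      \<in> set (coset q ss (log_vector ss v w) (log_vector ss h h') (map (\<lambda>i. digits_of (i * h) (i * h')) [0..r - 1]))"
      using coset_nth[of "nat i" "map (\<lambda>i. digits_of (i * h) (i * h')) [0..r - 1]"] i by simp
    moreover have "feasible qs (compile p p' qs cs') (shift (digits_of v w) (digits_of (i * h) (i * h'))) (p ^ a * p' ^ b)"
      using Cons.IH[OF val i(3) Cons.prems(3)] by (simp add: shift_digits_of)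
    ultimately show ?thesis
      unfolding cs Refine using slot_logs_digits_of[OF m] by (auto simp: ss_def Let_def)
  qed
qed

section \<open>Lookup tables\<close>

text \<open>
  The search is evaluated by rewriting alone.  It contains no conditional expressions, since the
  simplifier would traverse the whole search again whenever one of them is reduced.
\<close>

definition exhausts_z where
  "exhausts_z zs r hx hy ps x y z \<longleftrightarrow>
     (\<forall>(rz, hz) \<in> set zs. r = rz \<longrightarrow> exhausts ps (shift x hx) (shift y hy) (shift z hz))"

definition exhausts_if where
  "exhausts_if b hz zs r hx hy ps x y z \<longleftrightarrow>
     (b \<longrightarrow> exhausts ps (shift x hx) (shift y hy) (shift z hz)) \<and> exhausts_z zs r hx hy ps x y z"

definition exhausts_y where
  "exhausts_y ys rx hx zs q ps x y z \<longleftrightarrow> (\<forall>(ry, hy) \<in> set ys. exhausts_z zs (pred_mod q (rx + ry)) hx hy ps x y z)"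

definition exhausts_x where
  "exhausts_x xs ys zs q ps x y z \<longleftrightarrow> (\<forall>(rx, hx) \<in> set xs. exhausts_y ys rx hx zs q ps x y z)"

text \<open>The bounded quantifiers become recursion over explicit lists. The comparison of residues
  is an argument of \<open>exhausts_if\<close>, and its truth value selects the rule that
  applies.\<close>

lemma exhausts_rewrites:
  "exhausts ((q, sx, sy, sz) # ps) x y z =
     exhausts_x (children q sx x) (children q sy y) (children q sz z) q ps x y z"
  "exhausts_x [] ys zs q ps x y z = True"
  "exhausts_x ((rx, hx) # xs) ys zs q ps x y z = (exhausts_y ys rx hx zs q ps x y z \<and> exhausts_x xs ys zs q ps x y z)"
  "exhausts_y [] rx hx zs q ps x y z = True"
  "exhausts_y ((ry, hy) # ys) rx hx zs q ps x y z =
     (exhausts_z zs (pred_mod q (rx + ry)) hx hy ps x y z \<and> exhausts_y ys rx hx zs q ps x y z)"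
  "exhausts_z [] r hx hy ps x y z = True"
  "exhausts_z ((rz, hz) # zs) r hx hy ps x y z = exhausts_if (r = rz) hz zs r hx hy ps x y z"
  "exhausts_if False hz zs r hx hy ps x y z = exhausts_z zs r hx hy ps x y z"
  "exhausts_if True hz zs r hx hy ps x y z =
     (exhausts ps (shift x hx) (shift y hy) (shift z hz) \<and> exhausts_z zs r hx hy ps x y z)"
  by (simp_all add: exhausts_x_def exhausts_y_def exhausts_z_def exhausts_if_def)

declare exhausts.simps [simp del] search.simps [simp del] upto.simps [simp]

section \<open>Tabulated generators, logarithms, modular arithmetic and units\<close>

lemmas gens_simps [simp] =
  gens_def[of 3, unfolded unit_table_def, simplified] gens_def[of 4, unfolded unit_table_def, simplified]
  gens_def[of 8, unfolded unit_table_def, simplified] gens_def[of 5, unfolded unit_table_def, simplified]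
  gens_def[of 7, unfolded unit_table_def, simplified] gens_def[of 13, unfolded unit_table_def, simplified]
  gens_def[of 9, unfolded unit_table_def, simplified] gens_def[of 19, unfolded unit_table_def, simplified]
  gens_def[of 16, unfolded unit_table_def, simplified] gens_def[of 37, unfolded unit_table_def, simplified]
  gens_def[of 27, unfolded unit_table_def, simplified] gens_def[of 73, unfolded unit_table_def, simplified]
  gens_def[of 17, unfolded unit_table_def, simplified] gens_def[of 181, unfolded unit_table_def, simplified]
  gens_def[of 11, unfolded unit_table_def, simplified] gens_def[of 61, unfolded unit_table_def, simplified]
  gens_def[of 41, unfolded unit_table_def, simplified] gens_def[of 25, unfolded unit_table_def, simplified]
  gens_def[of 241, unfolded unit_table_def, simplified] gens_def[of 32, unfolded unit_table_def, simplified]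
  gens_def[of 199, unfolded unit_table_def, simplified] gens_def[of 121, unfolded unit_table_def, simplified]
  gens_def[of 89, unfolded unit_table_def, simplified] gens_def[of 23, unfolded unit_table_def, simplified]

lemmas logs_simps [simp] =
  logs_def[of 3, unfolded unit_table_def, simplified] logs_def[of 4, unfolded unit_table_def, simplified]
  logs_def[of 8, unfolded unit_table_def, simplified] logs_def[of 5, unfolded unit_table_def, simplified]
  logs_def[of 7, unfolded unit_table_def, simplified] logs_def[of 13, unfolded unit_table_def, simplified]
  logs_def[of 9, unfolded unit_table_def, simplified] logs_def[of 19, unfolded unit_table_def, simplified]
  logs_def[of 16, unfolded unit_table_def, simplified] logs_def[of 37, unfolded unit_table_def, simplified]
  logs_def[of 27, unfolded unit_table_def, simplified] logs_def[of 73, unfolded unit_table_def, simplified]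
  logs_def[of 17, unfolded unit_table_def, simplified] logs_def[of 181, unfolded unit_table_def, simplified]
  logs_def[of 11, unfolded unit_table_def, simplified] logs_def[of 61, unfolded unit_table_def, simplified]
  logs_def[of 41, unfolded unit_table_def, simplified] logs_def[of 25, unfolded unit_table_def, simplified]
  logs_def[of 241, unfolded unit_table_def, simplified] logs_def[of 32, unfolded unit_table_def, simplified]
  logs_def[of 199, unfolded unit_table_def, simplified] logs_def[of 121, unfolded unit_table_def, simplified]
  logs_def[of 89, unfolded unit_table_def, simplified] logs_def[of 23, unfolded unit_table_def, simplified]

text \<open>Each equation instantiates a definition; \<open>simplified\<close> later splits the
  bounded quantifiers into one rewrite rule per entry. In these tables the second factor of
  \<open>mmul\<close> runs up to 15 (or 8) also for smaller orders, because digits are stored modulo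
  16 (or 9).\<close>

lemma madd_2: "list_all (\<lambda>x. list_all (\<lambda>y. madd 2 x y = (x + y) mod 2) [0..1]) [0..1]"
  and mmul_2: "list_all (\<lambda>x. list_all (\<lambda>y. mmul 2 x y = (x * y) mod 2) [0..15]) [0..1]"
  by (simp_all add: madd_def mmul_def list_all_iff)

lemma madd_4: "list_all (\<lambda>x. list_all (\<lambda>y. madd 4 x y = (x + y) mod 4) [0..3]) [0..3]"
  and mmul_4: "list_all (\<lambda>x. list_all (\<lambda>y. mmul 4 x y = (x * y) mod 4) [0..15]) [0..3]"
  by (simp_all add: madd_def mmul_def list_all_iff)

lemma madd_8: "list_all (\<lambda>x. list_all (\<lambda>y. madd 8 x y = (x + y) mod 8) [0..7]) [0..7]"
  and mmul_8: "list_all (\<lambda>x. list_all (\<lambda>y. mmul 8 x y = (x * y) mod 8) [0..15]) [0..7]"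
  by (simp_all add: madd_def mmul_def list_all_iff)

lemma madd_16: "list_all (\<lambda>x. list_all (\<lambda>y. madd 16 x y = (x + y) mod 16) [0..15]) [0..15]"
  and mmul_16: "list_all (\<lambda>x. list_all (\<lambda>y. mmul 16 x y = (x * y) mod 16) [0..15]) [0..15]"
  by (simp_all add: madd_def mmul_def list_all_iff)

lemma madd_3: "list_all (\<lambda>x. list_all (\<lambda>y. madd 3 x y = (x + y) mod 3) [0..2]) [0..2]"
  and mmul_3: "list_all (\<lambda>x. list_all (\<lambda>y. mmul 3 x y = (x * y) mod 3) [0..8]) [0..2]"
  by (simp_all add: madd_def mmul_def list_all_iff)

lemma madd_9: "list_all (\<lambda>x. list_all (\<lambda>y. madd 9 x y = (x + y) mod 9) [0..8]) [0..8]"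
  and mmul_9: "list_all (\<lambda>x. list_all (\<lambda>y. mmul 9 x y = (x * y) mod 9) [0..8]) [0..8]"
  by (simp_all add: madd_def mmul_def list_all_iff)

lemma madd_5: "list_all (\<lambda>x. list_all (\<lambda>y. madd 5 x y = (x + y) mod 5) [0..4]) [0..4]"
  and mmul_5: "list_all (\<lambda>x. list_all (\<lambda>y. mmul 5 x y = (x * y) mod 5) [0..4]) [0..4]"
  by (simp_all add: madd_def mmul_def list_all_iff)

lemma madd_11: "list_all (\<lambda>x. list_all (\<lambda>y. madd 11 x y = (x + y) mod 11) [0..10]) [0..10]"
  and mmul_11: "list_all (\<lambda>x. list_all (\<lambda>y. mmul 11 x y = (x * y) mod 11) [0..10]) [0..10]"
  by (simp_all add: madd_def mmul_def list_all_iff)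

lemmas arith_tables =
  madd_2[simplified] madd_4[simplified] madd_8[simplified] madd_16[simplified]
  madd_3[simplified] madd_9[simplified] madd_5[simplified] madd_11[simplified]
  mmul_2[simplified] mmul_4[simplified] mmul_8[simplified] mmul_16[simplified]
  mmul_3[simplified] mmul_9[simplified] mmul_5[simplified] mmul_11[simplified]

definition power_mod :: "int \<Rightarrow> int \<Rightarrow> int \<Rightarrow> int" where
  "power_mod q g l = g ^ nat l mod q"

text \<open>The unit groups in the table have one, two or three generators. Reducing after each
  product keeps the numbers small when the unit tables are computed.\<close>

lemma unit_of_logs_power_mod:
  "gens q = [(m, g)] \<Longrightarrow> unit_of_logs q [a] = power_mod q g a"
  "gens q = [(m, g), (m', g')] \<Longrightarrow> unit_of_logs q [a, b] = (power_mod q g a * power_mod q g' b) mod q"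
  "gens q = [(m, g), (m', g'), (m'', g'')] \<Longrightarrow>
     unit_of_logs q [a, b, c] = (power_mod q g a * (power_mod q g' b * power_mod q g'' c mod q)) mod q"
  by (simp_all add: unit_of_logs_def power_mod_def mod_simps)

lemma power_mod_all:
  "list_all (\<lambda>l. power_mod 3 2 l = 2 ^ nat l mod 3) [0..1]"
  "list_all (\<lambda>l. power_mod 4 3 l = 3 ^ nat l mod 4) [0..1]"
  "list_all (\<lambda>l. power_mod 8 7 l = 7 ^ nat l mod 8) [0..1]"
  "list_all (\<lambda>l. power_mod 8 5 l = 5 ^ nat l mod 8) [0..1]"
  "list_all (\<lambda>l. power_mod 5 2 l = 2 ^ nat l mod 5) [0..3]"
  "list_all (\<lambda>l. power_mod 7 6 l = 6 ^ nat l mod 7) [0..1]"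
  "list_all (\<lambda>l. power_mod 7 2 l = 2 ^ nat l mod 7) [0..2]"
  "list_all (\<lambda>l. power_mod 13 8 l = 8 ^ nat l mod 13) [0..3]"
  "list_all (\<lambda>l. power_mod 13 3 l = 3 ^ nat l mod 13) [0..2]"
  "list_all (\<lambda>l. power_mod 9 8 l = 8 ^ nat l mod 9) [0..1]"
  "list_all (\<lambda>l. power_mod 9 4 l = 4 ^ nat l mod 9) [0..2]"
  "list_all (\<lambda>l. power_mod 19 18 l = 18 ^ nat l mod 19) [0..1]"
  "list_all (\<lambda>l. power_mod 19 4 l = 4 ^ nat l mod 19) [0..8]"
  "list_all (\<lambda>l. power_mod 16 15 l = 15 ^ nat l mod 16) [0..1]"
  "list_all (\<lambda>l. power_mod 16 5 l = 5 ^ nat l mod 16) [0..3]"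
  "list_all (\<lambda>l. power_mod 37 31 l = 31 ^ nat l mod 37) [0..3]"
  "list_all (\<lambda>l. power_mod 37 16 l = 16 ^ nat l mod 37) [0..8]"
  "list_all (\<lambda>l. power_mod 27 26 l = 26 ^ nat l mod 27) [0..1]"
  "list_all (\<lambda>l. power_mod 27 4 l = 4 ^ nat l mod 27) [0..8]"
  "list_all (\<lambda>l. power_mod 73 10 l = 10 ^ nat l mod 73) [0..7]"
  "list_all (\<lambda>l. power_mod 73 2 l = 2 ^ nat l mod 73) [0..8]"
  "list_all (\<lambda>l. power_mod 17 3 l = 3 ^ nat l mod 17) [0..15]"
  "list_all (\<lambda>l. power_mod 181 162 l = 162 ^ nat l mod 181) [0..3]"
  "list_all (\<lambda>l. power_mod 181 43 l = 43 ^ nat l mod 181) [0..8]"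
  "list_all (\<lambda>l. power_mod 181 59 l = 59 ^ nat l mod 181) [0..4]"
  "list_all (\<lambda>l. power_mod 11 10 l = 10 ^ nat l mod 11) [0..1]"
  "list_all (\<lambda>l. power_mod 11 4 l = 4 ^ nat l mod 11) [0..4]"
  "list_all (\<lambda>l. power_mod 61 11 l = 11 ^ nat l mod 61) [0..3]"
  "list_all (\<lambda>l. power_mod 61 47 l = 47 ^ nat l mod 61) [0..2]"
  "list_all (\<lambda>l. power_mod 61 9 l = 9 ^ nat l mod 61) [0..4]"
  "list_all (\<lambda>l. power_mod 41 27 l = 27 ^ nat l mod 41) [0..7]"
  "list_all (\<lambda>l. power_mod 41 10 l = 10 ^ nat l mod 41) [0..4]"
  "list_all (\<lambda>l. power_mod 25 7 l = 7 ^ nat l mod 25) [0..3]"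
  "list_all (\<lambda>l. power_mod 25 16 l = 16 ^ nat l mod 25) [0..4]"
  "list_all (\<lambda>l. power_mod 241 111 l = 111 ^ nat l mod 241) [0..15]"
  "list_all (\<lambda>l. power_mod 241 15 l = 15 ^ nat l mod 241) [0..2]"
  "list_all (\<lambda>l. power_mod 241 91 l = 91 ^ nat l mod 241) [0..4]"
  "list_all (\<lambda>l. power_mod 32 31 l = 31 ^ nat l mod 32) [0..1]"
  "list_all (\<lambda>l. power_mod 32 5 l = 5 ^ nat l mod 32) [0..7]"
  "list_all (\<lambda>l. power_mod 199 198 l = 198 ^ nat l mod 199) [0..1]"
  "list_all (\<lambda>l. power_mod 199 175 l = 175 ^ nat l mod 199) [0..8]"
  "list_all (\<lambda>l. power_mod 199 125 l = 125 ^ nat l mod 199) [0..10]"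
  "list_all (\<lambda>l. power_mod 121 120 l = 120 ^ nat l mod 121) [0..1]"
  "list_all (\<lambda>l. power_mod 121 81 l = 81 ^ nat l mod 121) [0..4]"
  "list_all (\<lambda>l. power_mod 121 56 l = 56 ^ nat l mod 121) [0..10]"
  "list_all (\<lambda>l. power_mod 89 37 l = 37 ^ nat l mod 89) [0..7]"
  "list_all (\<lambda>l. power_mod 89 64 l = 64 ^ nat l mod 89) [0..10]"
  "list_all (\<lambda>l. power_mod 23 22 l = 22 ^ nat l mod 23) [0..1]"
  "list_all (\<lambda>l. power_mod 23 2 l = 2 ^ nat l mod 23) [0..10]"
  by (simp_all add: power_mod_def list_all_iff)

lemmas power_mod_simps [simp] = power_mod_all[simplified]

text \<open>One entry per logarithm vector. The range for \<open>pred_mod\<close> ends at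
  \<open>2 * (q - 1)\<close>, the largest sum of two residues modulo \<open>q\<close>. The same
  pattern is followed for every other modulus.\<close>

lemma units_3: "list_all (\<lambda>a. unit_of_logs 3 [a] =
    power_mod 3 2 a) [0..1]"
  and pred_3: "list_all (\<lambda>s. pred_mod 3 s = (s - 1) mod 3) [0..4]"
  by (simp_all add: unit_of_logs_power_mod pred_mod_def list_all_iff)

lemma units_4: "list_all (\<lambda>a. unit_of_logs 4 [a] =
    power_mod 4 3 a) [0..1]"
  and pred_4: "list_all (\<lambda>s. pred_mod 4 s = (s - 1) mod 4) [0..6]"
  by (simp_all add: unit_of_logs_power_mod pred_mod_def list_all_iff)

lemma units_8: "list_all (\<lambda>a. list_all (\<lambda>b. unit_of_logs 8 [a, b] =
    (power_mod 8 7 a * power_mod 8 5 b) mod 8) [0..1]) [0..1]"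
  and pred_8: "list_all (\<lambda>s. pred_mod 8 s = (s - 1) mod 8) [0..14]"
  by (simp_all add: unit_of_logs_power_mod pred_mod_def list_all_iff)

lemma units_5: "list_all (\<lambda>a. unit_of_logs 5 [a] =
    power_mod 5 2 a) [0..3]"
  and pred_5: "list_all (\<lambda>s. pred_mod 5 s = (s - 1) mod 5) [0..8]"
  by (simp_all add: unit_of_logs_power_mod pred_mod_def list_all_iff)

lemma units_7: "list_all (\<lambda>a. list_all (\<lambda>b. unit_of_logs 7 [a, b] =
    (power_mod 7 6 a * power_mod 7 2 b) mod 7) [0..2]) [0..1]"
  and pred_7: "list_all (\<lambda>s. pred_mod 7 s = (s - 1) mod 7) [0..12]"
  by (simp_all add: unit_of_logs_power_mod pred_mod_def list_all_iff)

lemma units_13: "list_all (\<lambda>a. list_all (\<lambda>b. unit_of_logs 13 [a, b] =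
    (power_mod 13 8 a * power_mod 13 3 b) mod 13) [0..2]) [0..3]"
  and pred_13: "list_all (\<lambda>s. pred_mod 13 s = (s - 1) mod 13) [0..24]"
  by (simp_all add: unit_of_logs_power_mod pred_mod_def list_all_iff)

lemma units_9: "list_all (\<lambda>a. list_all (\<lambda>b. unit_of_logs 9 [a, b] =
    (power_mod 9 8 a * power_mod 9 4 b) mod 9) [0..2]) [0..1]"
  and pred_9: "list_all (\<lambda>s. pred_mod 9 s = (s - 1) mod 9) [0..16]"
  by (simp_all add: unit_of_logs_power_mod pred_mod_def list_all_iff)

lemma units_19: "list_all (\<lambda>a. list_all (\<lambda>b. unit_of_logs 19 [a, b] =
    (power_mod 19 18 a * power_mod 19 4 b) mod 19) [0..8]) [0..1]"
  and pred_19: "list_all (\<lambda>s. pred_mod 19 s = (s - 1) mod 19) [0..36]"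
  by (simp_all add: unit_of_logs_power_mod pred_mod_def list_all_iff)

lemma units_16: "list_all (\<lambda>a. list_all (\<lambda>b. unit_of_logs 16 [a, b] =
    (power_mod 16 15 a * power_mod 16 5 b) mod 16) [0..3]) [0..1]"
  and pred_16: "list_all (\<lambda>s. pred_mod 16 s = (s - 1) mod 16) [0..30]"
  by (simp_all add: unit_of_logs_power_mod pred_mod_def list_all_iff)

lemma units_37: "list_all (\<lambda>a. list_all (\<lambda>b. unit_of_logs 37 [a, b] =
    (power_mod 37 31 a * power_mod 37 16 b) mod 37) [0..8]) [0..3]"
  and pred_37: "list_all (\<lambda>s. pred_mod 37 s = (s - 1) mod 37) [0..72]"
  by (simp_all add: unit_of_logs_power_mod pred_mod_def list_all_iff)

lemma units_27: "list_all (\<lambda>a. list_all (\<lambda>b. unit_of_logs 27 [a, b] =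
    (power_mod 27 26 a * power_mod 27 4 b) mod 27) [0..8]) [0..1]"
  and pred_27: "list_all (\<lambda>s. pred_mod 27 s = (s - 1) mod 27) [0..52]"
  by (simp_all add: unit_of_logs_power_mod pred_mod_def list_all_iff)

lemma units_73: "list_all (\<lambda>a. list_all (\<lambda>b. unit_of_logs 73 [a, b] =
    (power_mod 73 10 a * power_mod 73 2 b) mod 73) [0..8]) [0..7]"
  and pred_73: "list_all (\<lambda>s. pred_mod 73 s = (s - 1) mod 73) [0..144]"
  by (simp_all add: unit_of_logs_power_mod pred_mod_def list_all_iff)

lemma units_17: "list_all (\<lambda>a. unit_of_logs 17 [a] =
    power_mod 17 3 a) [0..15]"
  and pred_17: "list_all (\<lambda>s. pred_mod 17 s = (s - 1) mod 17) [0..32]"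
  by (simp_all add: unit_of_logs_power_mod pred_mod_def list_all_iff)

lemma units_181: "list_all (\<lambda>a. list_all (\<lambda>b. list_all (\<lambda>c. unit_of_logs 181 [a, b, c] =
    (power_mod 181 162 a * (power_mod 181 43 b * power_mod 181 59 c mod 181)) mod 181) [0..4]) [0..8]) [0..3]"
  and pred_181: "list_all (\<lambda>s. pred_mod 181 s = (s - 1) mod 181) [0..360]"
  by (simp_all add: unit_of_logs_power_mod pred_mod_def list_all_iff)

lemma units_11: "list_all (\<lambda>a. list_all (\<lambda>b. unit_of_logs 11 [a, b] =
    (power_mod 11 10 a * power_mod 11 4 b) mod 11) [0..4]) [0..1]"
  and pred_11: "list_all (\<lambda>s. pred_mod 11 s = (s - 1) mod 11) [0..20]"
  by (simp_all add: unit_of_logs_power_mod pred_mod_def list_all_iff)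

lemma units_61: "list_all (\<lambda>a. list_all (\<lambda>b. list_all (\<lambda>c. unit_of_logs 61 [a, b, c] =
    (power_mod 61 11 a * (power_mod 61 47 b * power_mod 61 9 c mod 61)) mod 61) [0..4]) [0..2]) [0..3]"
  and pred_61: "list_all (\<lambda>s. pred_mod 61 s = (s - 1) mod 61) [0..120]"
  by (simp_all add: unit_of_logs_power_mod pred_mod_def list_all_iff)

lemma units_41: "list_all (\<lambda>a. list_all (\<lambda>b. unit_of_logs 41 [a, b] =
    (power_mod 41 27 a * power_mod 41 10 b) mod 41) [0..4]) [0..7]"
  and pred_41: "list_all (\<lambda>s. pred_mod 41 s = (s - 1) mod 41) [0..80]"
  by (simp_all add: unit_of_logs_power_mod pred_mod_def list_all_iff)

lemma units_25: "list_all (\<lambda>a. list_all (\<lambda>b. unit_of_logs 25 [a, b] =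
    (power_mod 25 7 a * power_mod 25 16 b) mod 25) [0..4]) [0..3]"
  and pred_25: "list_all (\<lambda>s. pred_mod 25 s = (s - 1) mod 25) [0..48]"
  by (simp_all add: unit_of_logs_power_mod pred_mod_def list_all_iff)

lemma units_241: "list_all (\<lambda>a. list_all (\<lambda>b. list_all (\<lambda>c. unit_of_logs 241 [a, b, c] =
    (power_mod 241 111 a * (power_mod 241 15 b * power_mod 241 91 c mod 241)) mod 241) [0..4]) [0..2]) [0..15]"
  and pred_241: "list_all (\<lambda>s. pred_mod 241 s = (s - 1) mod 241) [0..480]"
  by (simp_all add: unit_of_logs_power_mod pred_mod_def list_all_iff)

lemma units_32: "list_all (\<lambda>a. list_all (\<lambda>b. unit_of_logs 32 [a, b] =
    (power_mod 32 31 a * power_mod 32 5 b) mod 32) [0..7]) [0..1]"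
  and pred_32: "list_all (\<lambda>s. pred_mod 32 s = (s - 1) mod 32) [0..62]"
  by (simp_all add: unit_of_logs_power_mod pred_mod_def list_all_iff)

lemma units_199: "list_all (\<lambda>a. list_all (\<lambda>b. list_all (\<lambda>c. unit_of_logs 199 [a, b, c] =
    (power_mod 199 198 a * (power_mod 199 175 b * power_mod 199 125 c mod 199)) mod 199) [0..10]) [0..8]) [0..1]"
  and pred_199: "list_all (\<lambda>s. pred_mod 199 s = (s - 1) mod 199) [0..396]"
  by (simp_all add: unit_of_logs_power_mod pred_mod_def list_all_iff)

lemma units_121: "list_all (\<lambda>a. list_all (\<lambda>b. list_all (\<lambda>c. unit_of_logs 121 [a, b, c] =
    (power_mod 121 120 a * (power_mod 121 81 b * power_mod 121 56 c mod 121)) mod 121) [0..10]) [0..4]) [0..1]"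
  and pred_121: "list_all (\<lambda>s. pred_mod 121 s = (s - 1) mod 121) [0..240]"
  by (simp_all add: unit_of_logs_power_mod pred_mod_def list_all_iff)

lemma units_89: "list_all (\<lambda>a. list_all (\<lambda>b. unit_of_logs 89 [a, b] =
    (power_mod 89 37 a * power_mod 89 64 b) mod 89) [0..10]) [0..7]"
  and pred_89: "list_all (\<lambda>s. pred_mod 89 s = (s - 1) mod 89) [0..176]"
  by (simp_all add: unit_of_logs_power_mod pred_mod_def list_all_iff)

lemma units_23: "list_all (\<lambda>a. list_all (\<lambda>b. unit_of_logs 23 [a, b] =
    (power_mod 23 22 a * power_mod 23 2 b) mod 23) [0..10]) [0..1]"
  and pred_23: "list_all (\<lambda>s. pred_mod 23 s = (s - 1) mod 23) [0..44]"
  by (simp_all add: unit_of_logs_power_mod pred_mod_def list_all_iff)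

lemmas unit_tables =
  units_3[simplified] pred_3[simplified] units_4[simplified] pred_4[simplified] units_8[simplified] pred_8[simplified]
  units_5[simplified] pred_5[simplified] units_7[simplified] pred_7[simplified] units_13[simplified] pred_13[simplified]
  units_9[simplified] pred_9[simplified] units_19[simplified] pred_19[simplified] units_16[simplified] pred_16[simplified]
  units_37[simplified] pred_37[simplified] units_27[simplified] pred_27[simplified] units_73[simplified] pred_73[simplified]
  units_17[simplified] pred_17[simplified] units_181[simplified] pred_181[simplified] units_11[simplified] pred_11[simplified]
  units_61[simplified] pred_61[simplified] units_41[simplified] pred_41[simplified] units_25[simplified] pred_25[simplified]
  units_241[simplified] pred_241[simplified] units_32[simplified] pred_32[simplified] units_199[simplified] pred_199[simplified]
  units_121[simplified] pred_121[simplified] units_89[simplified] pred_89[simplified] units_23[simplified] pred_23[simplified]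

lemmas search_rewrites = exhausts_rewrites exhausts.simps(1) search.simps children.simps coset.simps
  slot_logs.simps add_logs.simps shift.simps slot_log_simps arith_tables unit_tables
  arith_simps arith_special rel_simps add_0_left add_0_right simp_thms

lemma ok_gens_all: "list_all ok_gens (map fst unit_table)"
  by (simp add: ok_gens_def slot_modulus_def unit_table_def)

lemmas ok_gens_simps [simp] = ok_gens_all[unfolded unit_table_def, simplified]

text \<open>All moduli are prime powers, so a prime has logarithms modulo \<open>q\<close> exactly
  if it does not divide \<open>q\<close>; the base 1 always has them.\<close>

lemma ok_logs_all: "list_all (\<lambda>q. list_all (ok_logs q) (filter (\<lambda>p. p = 1 \<or> q mod p \<noteq> 0) [1, 3, 5, 7, 11, 13, 17, 19]))
  (map fst unit_table)"
  by (simp add: ok_logs_def unit_table_def)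

lemmas ok_logs_simps [simp] = ok_logs_all[unfolded unit_table_def, simplified]

section \<open>Six odd primes with large exponents\<close>

text \<open>Every prime from 3 to 19 occurs, some also with higher powers, so each term vanishes at
  the moduli belonging to its own primes. The last four moduli are those whose unit group has order
  divisible by 11.\<close>

definition moduli :: "int list" where
  "moduli = [3, 4, 8, 5, 7, 13, 9, 19, 16, 37, 27, 73, 17, 181, 11, 61, 41, 25, 241, 32, 199, 121, 89, 23]"

text \<open>
  The lattices are the kernels of the logarithm maps modulo the successive moduli, in Hermite normal
  form.
\<close>

definition cert_table :: "((int \<times> int) \<times> cert list) list" where
  "cert_table = [
   ((3, 5), [Vanish, Refine 2 1 0 2 0 1 1 0, Refine 2 0 1 2 0 2 0 1, Vanish, Refine 3 0 2 6 2 2 2 1,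
     Refine 6 2 2 6 0 12 0 1, Vanish, Refine 3 0 12 18 6 12 2 1, Refine 2 6 12 36 24 12 1 1,
     Refine 1 0 0 36 24 12 0 0, Vanish, Refine 6 24 12 36 0 72 0 1, Refine 4 36 0 144 72 72 1 2,
     Refine 5 72 72 720 648 72 1 1, Refine 5 648 72 720 360 360 0 1, Refine 1 0 0 720 360 360 0 0,
     Refine 1 0 0 720 360 360 0 0, Vanish, Refine 1 0 0 720 360 360 0 0,
     Refine 1 0 0 720 360 360 0 0, Refine 11 360 360 7920 1800 360 5 1,
     Refine 11 1800 360 7920 3960 3960 0 1, Refine 1 0 0 7920 3960 3960 0 0,
     Refine 1 0 0 7920 3960 3960 0 0]),
   ((3, 7), [Vanish, Refine 2 0 1 2 1 1 1 1, Refine 2 1 1 2 0 2 0 1, Refine 2 0 2 4 2 2 1 1, Vanish,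
     Refine 6 6 2 12 4 4 4 3, Vanish, Refine 9 4 4 36 0 12 3 1, Refine 1 0 0 36 0 12 0 0,
     Refine 3 0 12 36 0 36 0 1, Vanish, Refine 2 0 36 36 0 72 0 1, Refine 4 36 0 144 72 72 1 2,
     Refine 5 72 72 720 360 72 2 1, Refine 5 360 72 720 360 360 0 1, Refine 1 0 0 720 360 360 0 0,
     Refine 1 0 0 720 360 360 0 0, Refine 1 0 0 720 360 360 0 0, Refine 2 360 360 720 0 720 0 1,
     Refine 1 0 0 720 0 720 0 0, Refine 11 0 720 7920 720 720 10 1,
     Refine 11 720 720 7920 0 7920 0 1, Refine 1 0 0 7920 0 7920 0 0, Refine 1 0 0 7920 0 7920 0 0]),
   ((3, 11), [Vanish, Refine 2 0 1 2 1 1 1 1, Refine 1 0 0 2 1 1 0 0, Refine 4 1 1 4 0 2 2 1,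
     Refine 3 0 2 12 4 2 2 1, Refine 2 4 2 12 8 4 0 1, Vanish, Refine 9 8 4 36 0 12 6 1,
     Refine 1 0 0 36 0 12 0 0, Refine 1 0 0 36 0 12 0 0, Vanish, Refine 6 0 12 36 0 72 0 1,
     Refine 4 36 0 144 72 72 1 2, Refine 5 72 72 720 216 72 4 1, Vanish,
     Refine 5 216 72 720 360 360 0 1, Refine 1 0 0 720 360 360 0 0, Refine 1 0 0 720 360 360 0 0,
     Refine 2 360 360 720 0 720 0 1, Refine 1 0 0 720 0 720 0 0, Refine 11 0 720 7920 6480 720 6 1,
     Vanish, Refine 11 6480 720 7920 0 7920 0 1, Refine 1 0 0 7920 0 7920 0 0]),
   ((3, 13), [Vanish, Refine 2 1 0 2 0 1 1 0, Refine 2 0 1 2 0 2 0 1, Refine 2 0 2 4 2 2 1 1,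
     Refine 3 2 2 12 6 2 2 1, Vanish, Vanish, Refine 9 6 2 36 6 6 3 1, Refine 1 0 0 36 6 6 0 0,
     Refine 6 6 6 36 0 36 0 1, Vanish, Refine 2 0 36 36 0 72 0 1, Refine 4 36 0 144 0 72 1 0,
     Refine 5 0 72 720 432 72 3 1, Refine 5 432 72 720 0 360 0 1, Refine 1 0 0 720 0 360 0 0,
     Refine 1 0 0 720 0 360 0 0, Refine 1 0 0 720 0 360 0 0, Refine 2 0 360 720 0 720 0 1,
     Refine 1 0 0 720 0 720 0 0, Refine 11 0 720 7920 2880 720 8 1,
     Refine 11 2880 720 7920 0 7920 0 1, Refine 1 0 0 7920 0 7920 0 0, Refine 1 0 0 7920 0 7920 0 0]),
   ((3, 17), [Vanish, Refine 2 1 0 2 0 1 1 0, Refine 1 0 0 2 0 1 0 0, Refine 4 0 1 4 2 2 2 1,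
     Refine 3 2 2 12 10 2 1 1, Refine 3 10 2 12 6 6 0 1, Vanish, Refine 3 6 6 36 30 6 1 1,
     Refine 2 30 6 36 24 12 0 1, Refine 3 24 12 36 0 36 0 1, Vanish, Refine 2 0 36 36 0 72 0 1,
     Vanish, Refine 5 36 0 180 0 72 1 0, Refine 5 0 72 180 0 360 0 1, Refine 1 0 0 180 0 360 0 0,
     Refine 2 180 0 360 0 360 1 0, Refine 1 0 0 360 0 360 0 0, Refine 2 0 360 360 0 720 0 1,
     Refine 1 0 0 360 0 720 0 0, Refine 11 0 720 3960 2520 720 3 1,
     Refine 11 2520 720 3960 0 7920 0 1, Refine 1 0 0 3960 0 7920 0 0, Refine 1 0 0 3960 0 7920 0 0]),
   ((3, 19), [Vanish, Refine 2 0 1 2 1 1 1 1, Refine 1 0 0 2 1 1 0 0, Refine 4 1 1 4 0 2 2 1,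
     Refine 3 0 2 12 8 2 1 1, Refine 2 8 2 12 4 4 0 1, Vanish, Vanish, Refine 1 0 0 12 4 4 0 0,
     Refine 9 4 4 36 24 12 6 1, Vanish, Refine 3 24 12 36 0 36 0 1, Refine 4 36 0 144 72 36 1 2,
     Refine 5 72 36 720 360 36 2 1, Refine 5 360 36 720 360 180 0 1, Refine 1 0 0 720 360 180 0 0,
     Refine 2 360 180 720 0 360 0 1, Refine 1 0 0 720 0 360 0 0, Refine 2 0 360 720 0 720 0 1,
     Refine 1 0 0 720 0 720 0 0, Refine 11 720 0 7920 0 720 1 0, Refine 11 0 720 7920 0 7920 0 1,
     Refine 1 0 0 7920 0 7920 0 0, Refine 1 0 0 7920 0 7920 0 0]),
   ((5, 7), [Refine 2 1 0 2 0 1 1 0, Refine 2 0 1 2 0 2 0 1, Refine 1 0 0 2 0 2 0 0, Vanish, Vanish,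
     Refine 6 0 2 4 2 6 3 1, Refine 3 2 6 12 6 6 2 1, Refine 3 6 6 36 18 6 2 1,
     Refine 2 18 6 36 0 12 0 1, Refine 3 0 12 36 0 36 0 1, Refine 1 0 0 36 0 36 0 0,
     Refine 2 0 36 72 36 36 1 1, Refine 2 72 0 144 36 36 1 0, Refine 5 36 36 720 180 36 4 1,
     Refine 5 180 36 720 180 180 0 1, Refine 1 0 0 720 180 180 0 0,
     Refine 2 180 180 720 360 360 0 1, Vanish, Refine 2 360 360 720 0 720 0 1,
     Refine 1 0 0 720 0 720 0 0, Refine 11 0 720 7920 1440 720 5 1,
     Refine 11 1440 720 7920 0 7920 0 1, Refine 1 0 0 7920 0 7920 0 0, Refine 1 0 0 7920 0 7920 0 0]),
   ((5, 11), [Refine 2 0 1 2 1 1 1 1, Refine 2 1 1 2 0 2 0 1, Refine 1 0 0 2 0 2 0 0, Vanish,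
     Refine 3 0 2 6 2 2 2 1, Refine 6 8 2 12 6 6 3 4, Refine 1 0 0 12 6 6 0 0,
     Refine 3 6 6 36 18 6 2 1, Refine 1 0 0 36 18 6 0 0, Refine 2 18 6 36 0 12 0 1,
     Refine 3 0 12 36 0 36 0 1, Refine 2 0 36 72 36 36 1 1, Refine 2 72 0 144 36 36 1 0,
     Refine 5 36 36 720 468 36 3 1, Vanish, Refine 5 468 36 720 180 180 0 1,
     Refine 2 180 180 720 360 360 0 1, Vanish, Refine 2 360 360 720 0 720 0 1,
     Refine 1 0 0 720 0 720 0 0, Refine 11 0 720 7920 5040 720 3 1, Vanish,
     Refine 11 5040 720 7920 0 7920 0 1, Refine 1 0 0 7920 0 7920 0 0]),
   ((5, 13), [Refine 2 1 0 2 0 1 1 0, Refine 1 0 0 2 0 1 0 0, Refine 2 0 1 2 0 2 0 1, Vanish,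
     Refine 3 2 0 6 0 2 1 0, Vanish, Refine 3 0 2 6 0 6 0 1, Refine 3 0 6 18 6 6 2 1,
     Refine 2 18 0 36 6 6 1 0, Refine 3 6 6 36 18 18 0 1, Refine 1 0 0 36 18 18 0 0,
     Refine 2 36 0 72 18 18 1 0, Refine 8 18 18 144 0 72 4 1, Refine 5 0 72 720 432 72 3 1,
     Refine 1 0 0 720 432 72 0 0, Refine 5 432 72 720 0 360 0 1, Refine 1 0 0 720 0 360 0 0, Vanish,
     Refine 2 0 360 720 0 720 0 1, Refine 1 0 0 720 0 720 0 0, Refine 11 0 720 7920 5760 720 4 1,
     Refine 1 0 0 7920 5760 720 0 0, Refine 1 0 0 7920 5760 720 0 0, Refine 1 0 0 7920 5760 720 0 0]),
   ((5, 17), [Refine 2 0 1 2 1 1 1 1, Refine 1 0 0 2 1 1 0 0, Refine 2 1 1 2 0 2 0 1, Vanish,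
     Refine 3 0 2 6 2 2 2 1, Refine 6 2 2 12 0 6 3 1, Refine 1 0 0 12 0 6 0 0,
     Refine 3 0 6 36 12 6 2 1, Refine 1 0 0 36 12 6 0 0, Refine 6 12 6 36 0 36 0 1,
     Refine 1 0 0 36 0 36 0 0, Refine 2 0 36 72 36 36 1 1, Vanish, Refine 5 36 36 360 180 36 2 1,
     Refine 5 180 36 360 180 180 0 1, Refine 1 0 0 360 180 180 0 0, Refine 2 180 180 360 0 360 0 1,
     Vanish, Refine 2 0 360 360 0 720 0 1, Refine 1 0 0 360 0 720 0 0,
     Refine 11 0 720 3960 1080 720 7 1, Refine 11 1080 720 3960 0 7920 0 1,
     Refine 1 0 0 3960 0 7920 0 0, Refine 1 0 0 3960 0 7920 0 0]),
   ((5, 19), [Refine 2 1 0 2 0 1 1 0, Refine 2 0 1 2 0 2 0 1, Refine 1 0 0 2 0 2 0 0, Vanish,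
     Refine 3 0 2 6 4 2 1 1, Refine 6 4 2 12 6 6 3 1, Refine 1 0 0 12 6 6 0 0, Vanish,
     Refine 1 0 0 12 6 6 0 0, Refine 3 6 6 36 30 6 1 1, Refine 3 30 6 36 18 18 0 1,
     Refine 4 18 18 72 0 36 2 1, Refine 2 0 36 144 72 36 1 1, Refine 5 72 36 720 360 36 2 1,
     Refine 5 360 36 720 360 180 0 1, Refine 1 0 0 720 360 180 0 0, Refine 2 360 180 720 0 360 0 1,
     Vanish, Refine 2 0 360 720 0 720 0 1, Refine 1 0 0 720 0 720 0 0,
     Refine 11 720 0 7920 0 720 1 0, Refine 11 0 720 7920 0 7920 0 1, Refine 1 0 0 7920 0 7920 0 0,
     Refine 1 0 0 7920 0 7920 0 0]),
   ((7, 11), [Refine 2 0 1 1 0 2 0 1, Refine 2 1 0 2 0 2 1 0, Refine 1 0 0 2 0 2 0 0, Refine 2 2 0 4 0 2 1 0,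
     Vanish, Refine 6 0 2 12 4 4 4 1, Refine 3 4 4 12 0 12 0 1, Refine 1 0 0 12 0 12 0 0,
     Refine 1 0 0 12 0 12 0 0, Refine 3 12 0 36 0 12 1 0, Refine 3 0 12 36 0 36 0 1,
     Refine 2 0 36 72 36 36 1 1, Refine 2 36 36 144 108 36 1 1, Refine 5 108 36 144 108 180 0 1,
     Vanish, Refine 5 108 180 720 540 180 3 1, Refine 1 0 0 720 540 180 0 0,
     Refine 1 0 0 720 540 180 0 0, Refine 1 0 0 720 540 180 0 0, Refine 2 540 180 720 360 360 0 1,
     Refine 11 360 360 7920 4680 360 9 1, Vanish, Refine 11 4680 360 7920 3960 3960 0 1,
     Refine 1 0 0 7920 3960 3960 0 0]),
   ((7, 13), [Refine 1 0 0 1 0 1 0 0, Refine 2 1 0 2 0 1 1 0, Refine 2 0 1 2 0 2 0 1, Refine 2 0 2 4 2 2 1 1,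
     Vanish, Vanish, Refine 3 4 0 12 2 2 1 0, Refine 9 2 2 12 6 18 0 1, Refine 2 6 18 12 0 36 0 1,
     Refine 3 12 0 36 0 36 1 0, Refine 1 0 0 36 0 36 0 0, Refine 2 0 36 72 36 36 1 1,
     Refine 4 36 36 144 0 72 2 1, Refine 5 0 72 144 0 360 0 1, Refine 5 144 0 720 0 360 1 0,
     Refine 1 0 0 720 0 360 0 0, Refine 1 0 0 720 0 360 0 0, Refine 1 0 0 720 0 360 0 0,
     Refine 2 0 360 720 0 720 0 1, Refine 1 0 0 720 0 720 0 0, Refine 11 0 720 7920 5040 720 3 1,
     Refine 11 5040 720 7920 0 7920 0 1, Refine 1 0 0 7920 0 7920 0 0, Refine 1 0 0 7920 0 7920 0 0]),
   ((7, 17), [Refine 2 0 1 1 0 2 0 1, Refine 2 1 0 2 0 2 1 0, Refine 1 0 0 2 0 2 0 0, Refine 2 0 2 4 2 2 1 1,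
     Vanish, Refine 6 2 2 12 8 4 4 1, Refine 3 8 4 12 0 12 0 1, Refine 3 0 12 12 0 36 0 1,
     Refine 1 0 0 12 0 36 0 0, Refine 3 12 0 36 0 36 1 0, Refine 1 0 0 36 0 36 0 0,
     Refine 2 0 36 72 36 36 1 1, Vanish, Refine 1 0 0 72 36 36 0 0, Refine 5 36 36 360 108 36 4 1,
     Refine 5 108 36 360 180 180 0 1, Refine 1 0 0 360 180 180 0 0, Refine 1 0 0 360 180 180 0 0,
     Refine 2 360 0 720 180 180 1 0, Refine 1 0 0 720 180 180 0 0,
     Refine 11 180 180 7920 2340 180 7 1, Refine 11 2340 180 7920 1980 1980 0 1,
     Refine 2 1980 1980 7920 3960 3960 0 1, Refine 1 0 0 7920 3960 3960 0 0]),
   ((7, 19), [Refine 1 0 0 1 0 1 0 0, Refine 2 0 1 2 1 1 1 1, Refine 2 1 1 2 0 2 0 1, Refine 2 2 0 4 0 2 1 0,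
     Vanish, Refine 6 0 2 12 8 4 2 1, Refine 3 8 4 12 0 12 0 1, Vanish, Refine 1 0 0 12 0 12 0 0,
     Refine 3 0 12 36 24 12 1 1, Refine 3 24 12 36 0 36 0 1, Refine 2 36 0 72 0 36 1 0,
     Refine 2 0 36 144 72 36 1 1, Refine 1 0 0 144 72 36 0 0, Refine 5 72 36 720 216 36 4 1,
     Refine 1 0 0 720 216 36 0 0, Refine 10 216 36 720 0 360 0 1, Refine 1 0 0 720 0 360 0 0,
     Refine 2 0 360 720 0 720 0 1, Refine 1 0 0 720 0 720 0 0, Refine 11 720 0 7920 0 720 1 0,
     Refine 11 0 720 7920 0 7920 0 1, Refine 1 0 0 7920 0 7920 0 0, Refine 1 0 0 7920 0 7920 0 0]),
   ((11, 13), [Refine 2 1 0 2 0 1 1 0, Refine 1 0 0 2 0 1 0 0, Refine 2 0 1 2 0 2 0 1, Refine 2 0 2 2 0 4 0 1,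
     Refine 3 2 0 6 0 4 1 0, Vanish, Refine 3 0 4 6 0 12 0 1, Refine 3 0 12 6 0 36 0 1,
     Refine 2 6 0 12 0 36 1 0, Refine 1 0 0 12 0 36 0 0, Refine 3 12 0 36 0 36 1 0,
     Refine 2 0 36 72 36 36 1 1, Refine 4 36 36 144 0 72 2 1, Refine 5 0 72 720 576 72 1 1, Vanish,
     Refine 1 0 0 720 576 72 0 0, Refine 1 0 0 720 576 72 0 0, Refine 5 576 72 720 0 360 0 1,
     Refine 2 0 360 720 0 720 0 1, Refine 1 0 0 720 0 720 0 0, Refine 11 0 720 7920 1440 720 5 1,
     Vanish, Refine 11 1440 720 7920 0 7920 0 1, Refine 1 0 0 7920 0 7920 0 0]),
   ((11, 17), [Refine 2 0 1 2 1 1 1 1, Refine 2 1 1 2 0 2 0 1, Refine 1 0 0 2 0 2 0 0, Refine 2 0 2 2 0 4 0 1,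
     Refine 3 0 4 6 2 4 2 1, Refine 6 2 4 12 0 12 3 1, Refine 1 0 0 12 0 12 0 0,
     Refine 3 0 12 12 0 36 0 1, Refine 1 0 0 12 0 36 0 0, Refine 1 0 0 12 0 36 0 0,
     Refine 3 12 0 36 0 36 1 0, Refine 2 0 36 72 36 36 1 1, Vanish, Refine 5 36 36 360 180 36 2 1,
     Vanish, Refine 5 180 36 360 180 180 0 1, Refine 1 0 0 360 180 180 0 0,
     Refine 1 0 0 360 180 180 0 0, Refine 2 360 0 720 180 180 1 0, Refine 2 180 180 720 360 360 0 1,
     Refine 11 360 360 7920 7560 360 1 1, Vanish, Refine 11 7560 360 7920 3960 3960 0 1,
     Refine 1 0 0 7920 3960 3960 0 0]),
   ((11, 19), [Refine 2 1 0 2 0 1 1 0, Refine 2 0 1 2 0 2 0 1, Refine 1 0 0 2 0 2 0 0, Refine 1 0 0 2 0 2 0 0,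
     Refine 3 0 2 6 2 2 2 1, Refine 2 6 0 12 2 2 1 0, Refine 3 2 2 12 6 6 0 1, Vanish,
     Refine 1 0 0 12 6 6 0 0, Refine 6 6 6 12 0 36 0 1, Refine 3 12 0 36 0 36 1 0,
     Refine 2 36 0 72 0 36 1 0, Refine 2 0 36 144 72 36 1 1, Refine 5 72 36 720 360 36 2 1, Vanish,
     Refine 5 360 36 720 360 180 0 1, Refine 2 360 180 720 0 360 0 1, Refine 1 0 0 720 0 360 0 0,
     Refine 2 0 360 720 0 720 0 1, Refine 1 0 0 720 0 720 0 0, Refine 11 720 0 7920 0 720 1 0,
     Vanish, Refine 11 0 720 7920 0 7920 0 1, Refine 1 0 0 7920 0 7920 0 0]),
   ((13, 17), [Refine 2 0 1 1 0 2 0 1, Refine 1 0 0 1 0 2 0 0, Refine 2 1 0 2 0 2 1 0, Refine 2 0 2 4 2 2 1 1,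
     Refine 3 2 2 4 2 6 0 1, Vanish, Refine 3 2 6 12 6 6 2 1, Refine 3 12 0 36 6 6 1 0,
     Refine 2 6 6 36 12 12 0 1, Refine 1 0 0 36 12 12 0 0, Refine 3 12 12 36 0 36 0 1,
     Refine 2 0 36 72 36 36 1 1, Vanish, Refine 5 36 36 360 180 36 2 1,
     Refine 5 180 36 360 180 180 0 1, Refine 1 0 0 360 180 180 0 0, Refine 1 0 0 360 180 180 0 0,
     Refine 1 0 0 360 180 180 0 0, Refine 2 180 180 720 540 180 1 1,
     Refine 2 540 180 720 360 360 0 1, Refine 11 360 360 7920 6120 360 4 1,
     Refine 11 6120 360 7920 3960 3960 0 1, Refine 1 0 0 7920 3960 3960 0 0,
     Refine 1 0 0 7920 3960 3960 0 0]),
   ((13, 19), [Refine 1 0 0 1 0 1 0 0, Refine 2 0 1 1 0 2 0 1, Refine 2 1 0 2 0 2 1 0, Refine 2 2 0 4 0 2 1 0,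
     Refine 3 0 2 4 0 6 0 1, Vanish, Refine 3 4 0 12 0 6 1 0, Vanish, Refine 2 0 6 12 0 12 0 1,
     Refine 3 0 12 36 24 12 1 1, Refine 3 24 12 36 0 36 0 1, Refine 2 36 0 72 0 36 1 0,
     Refine 2 0 36 72 0 72 0 1, Refine 5 72 0 360 0 72 1 0, Refine 5 0 72 360 0 360 0 1,
     Refine 1 0 0 360 0 360 0 0, Refine 1 0 0 360 0 360 0 0, Refine 1 0 0 360 0 360 0 0,
     Refine 2 0 360 720 360 360 1 1, Refine 1 0 0 720 360 360 0 0,
     Refine 11 360 360 7920 3960 360 2 1, Refine 11 3960 360 7920 3960 3960 0 1,
     Refine 1 0 0 7920 3960 3960 0 0, Refine 1 0 0 7920 3960 3960 0 0]),
   ((17, 19), [Refine 2 1 0 2 0 1 1 0, Refine 2 0 1 2 0 2 0 1, Refine 1 0 0 2 0 2 0 0, Refine 2 2 0 4 0 2 1 0,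
     Refine 3 0 2 12 8 2 1 1, Refine 6 8 2 12 0 12 0 1, Refine 1 0 0 12 0 12 0 0, Vanish,
     Refine 1 0 0 12 0 12 0 0, Refine 3 0 12 36 12 12 2 1, Refine 1 0 0 36 12 12 0 0,
     Refine 6 12 12 72 0 36 3 1, Vanish, Refine 1 0 0 72 0 36 0 0, Refine 5 0 36 360 288 36 1 1,
     Refine 5 288 36 360 0 180 0 1, Refine 2 0 180 360 0 360 0 1, Refine 1 0 0 360 0 360 0 0,
     Refine 2 0 360 720 360 360 1 1, Refine 1 0 0 720 360 360 0 0,
     Refine 11 360 360 7920 3960 360 2 1, Refine 11 3960 360 7920 3960 3960 0 1,
     Refine 1 0 0 7920 3960 3960 0 0, Refine 1 0 0 7920 3960 3960 0 0])]"

text \<open>Exponents at least 6 make \<open>p ^ 6 * p' ^ 6\<close> a divisor of the term, hence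
  also the powers of \<open>p\<close> and \<open>p'\<close> among the moduli. The lattice
  \<open>(1, 0, 1)\<close> consists of all integer pairs, so the exponents start
  unrestricted.\<close>

lemma valid_cert_table:
  "list_all (\<lambda>((p, p'), cs). valid (p ^ 6 * p' ^ 6) p p' (1, 0, 1) moduli cs) cert_table"
  by (simp add: cert_table_def moduli_def ok_refine_def)

definition steps :: "int \<Rightarrow> int \<Rightarrow> step list" where
  "steps p p' = compile p p' moduli (the (map_of cert_table (p, p')))"

definition odd_primes :: "int list" where
  "odd_primes = [3, 5, 7, 11, 13, 17, 19]"

definition prime_pairs :: "(int \<times> int) list" where
  "prime_pairs = [(p, p'). p \<leftarrow> odd_primes, p' \<leftarrow> odd_primes, p < p']"

lemma map_fst_cert_table: "map fst cert_table = prime_pairs"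
  by (simp add: cert_table_def prime_pairs_def odd_primes_def)

lemma feasible_steps:
  assumes "(p, p') \<in> set prime_pairs" "6 \<le> a" "6 \<le> b"
  shows "feasible moduli (steps p p') (Digits 0 0 0 0 0 0 0 0) (p ^ a * p' ^ b)"
proof -
  obtain cs where cs: "map_of cert_table (p, p') = Some cs"
    using assms(1) unfolding map_fst_cert_table[symmetric] by (metis list.set_map map_of_eq_None_iff not_Some_eq)
  then have "((p, p'), cs) \<in> set cert_table"
    by (rule map_of_SomeD)
  then have "valid (p ^ 6 * p' ^ 6) p p' (1, 0, 1) moduli cs"
    using valid_cert_table by (auto simp: list_all_iff)
  then have "feasible moduli (compile p p' moduli cs) (digits_of 0 0) (p ^ a * p' ^ b)"
    by (rule valid_feasible) (use assms in \<open>auto simp: lattice_full intro: mult_dvd_mono le_imp_power_dvd\<close>)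
  then show ?thesis
    by (simp add: steps_def cs digits_of_def)
qed

fun excluded :: "int \<times> int \<Rightarrow> int \<times> int \<Rightarrow> int \<times> int \<Rightarrow> bool" where
  "excluded (p1, p2) (p3, p4) (p5, p6) = exhausts (search moduli (steps p1 p2) (steps p3 p4) (steps p5 p6))
     (Digits 0 0 0 0 0 0 0 0) (Digits 0 0 0 0 0 0 0 0) (Digits 0 0 0 0 0 0 0 0)"

lemma excluded_sound:
  assumes "excluded (p1, p2) (p3, p4) (p5, p6)"
    and "{(p1, p2), (p3, p4), (p5, p6)} \<subseteq> set prime_pairs"
    and "6 \<le> a1" "6 \<le> a2" "6 \<le> a3" "6 \<le> a4" "6 \<le> a5" "6 \<le> a6"
  shows "p1 ^ a1 * p2 ^ a2 + p3 ^ a3 * p4 ^ a4 \<noteq> p5 ^ a5 * p6 ^ a6 + 1"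
  by (rule exhausts_sound[OF _ feasible_steps feasible_steps feasible_steps]) (use assms in auto)

text \<open>The two summands commute, so only the order with the smaller first prime is listed. Each
  of the 21 pairs \<open>z\<close> has 15 partners: 5 choices of four remaining primes, times 3 ways
  to pair them.\<close>

definition partners :: "int \<times> int \<Rightarrow> ((int \<times> int) \<times> (int \<times> int)) list" where
  "partners z = [(x, y). x \<leftarrow> prime_pairs, y \<leftarrow> prime_pairs, fst x < fst y,
     distinct [fst x, snd x, fst y, snd y, fst z, snd z]]"

declare digits_of_def [simp] log_vector_def [simp] Let_def [simp]

text \<open>Evaluates the compiled step lists once and for all to explicit data, so that the
  searches never unfold \<open>compile\<close>.\<close>

lemmas steps_simps =
  steps_def[of 3 5, unfolded moduli_def cert_table_def, simplified] steps_def[of 3 7, unfolded moduli_def cert_table_def, simplified]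
  steps_def[of 3 11, unfolded moduli_def cert_table_def, simplified] steps_def[of 3 13, unfolded moduli_def cert_table_def, simplified]
  steps_def[of 3 17, unfolded moduli_def cert_table_def, simplified] steps_def[of 3 19, unfolded moduli_def cert_table_def, simplified]
  steps_def[of 5 7, unfolded moduli_def cert_table_def, simplified] steps_def[of 5 11, unfolded moduli_def cert_table_def, simplified]
  steps_def[of 5 13, unfolded moduli_def cert_table_def, simplified] steps_def[of 5 17, unfolded moduli_def cert_table_def, simplified]
  steps_def[of 5 19, unfolded moduli_def cert_table_def, simplified] steps_def[of 7 11, unfolded moduli_def cert_table_def, simplified]
  steps_def[of 7 13, unfolded moduli_def cert_table_def, simplified] steps_def[of 7 17, unfolded moduli_def cert_table_def, simplified]
  steps_def[of 7 19, unfolded moduli_def cert_table_def, simplified] steps_def[of 11 13, unfolded moduli_def cert_table_def, simplified]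
  steps_def[of 11 17, unfolded moduli_def cert_table_def, simplified] steps_def[of 11 19, unfolded moduli_def cert_table_def, simplified]
  steps_def[of 13 17, unfolded moduli_def cert_table_def, simplified] steps_def[of 13 19, unfolded moduli_def cert_table_def, simplified]
  steps_def[of 17 19, unfolded moduli_def cert_table_def, simplified]

lemmas partners_simps =
  partners_def[of "(3, 5)", unfolded prime_pairs_def odd_primes_def, simplified]
  partners_def[of "(3, 7)", unfolded prime_pairs_def odd_primes_def, simplified]
  partners_def[of "(3, 11)", unfolded prime_pairs_def odd_primes_def, simplified]
  partners_def[of "(3, 13)", unfolded prime_pairs_def odd_primes_def, simplified]
  partners_def[of "(3, 17)", unfolded prime_pairs_def odd_primes_def, simplified]
  partners_def[of "(3, 19)", unfolded prime_pairs_def odd_primes_def, simplified]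
  partners_def[of "(5, 7)", unfolded prime_pairs_def odd_primes_def, simplified]
  partners_def[of "(5, 11)", unfolded prime_pairs_def odd_primes_def, simplified]
  partners_def[of "(5, 13)", unfolded prime_pairs_def odd_primes_def, simplified]
  partners_def[of "(5, 17)", unfolded prime_pairs_def odd_primes_def, simplified]
  partners_def[of "(5, 19)", unfolded prime_pairs_def odd_primes_def, simplified]
  partners_def[of "(7, 11)", unfolded prime_pairs_def odd_primes_def, simplified]
  partners_def[of "(7, 13)", unfolded prime_pairs_def odd_primes_def, simplified]
  partners_def[of "(7, 17)", unfolded prime_pairs_def odd_primes_def, simplified]
  partners_def[of "(7, 19)", unfolded prime_pairs_def odd_primes_def, simplified]
  partners_def[of "(11, 13)", unfolded prime_pairs_def odd_primes_def, simplified]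
  partners_def[of "(11, 17)", unfolded prime_pairs_def odd_primes_def, simplified]
  partners_def[of "(11, 19)", unfolded prime_pairs_def odd_primes_def, simplified]
  partners_def[of "(13, 17)", unfolded prime_pairs_def odd_primes_def, simplified]
  partners_def[of "(13, 19)", unfolded prime_pairs_def odd_primes_def, simplified]
  partners_def[of "(17, 19)", unfolded prime_pairs_def odd_primes_def, simplified]

declare upto.simps [simp del] digits_of_def [simp del] log_vector_def [simp del] Let_def [simp del]

section \<open>The 315 searches, grouped by the smaller prime of the subtracted term\<close>

lemma excluded_3:
  "list_all (\<lambda>z. list_all (\<lambda>(x, y). excluded x y z) (partners z)) [(3, 5), (3, 7), (3, 11), (3, 13), (3, 17), (3, 19)]"
  by (simp only: list.pred_inject prod.case partners_simps excluded.simps steps_simps moduli_def search_rewrites)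

lemma excluded_5:
  "list_all (\<lambda>z. list_all (\<lambda>(x, y). excluded x y z) (partners z)) [(5, 7), (5, 11), (5, 13), (5, 17), (5, 19)]"
  by (simp only: list.pred_inject prod.case partners_simps excluded.simps steps_simps moduli_def search_rewrites)

lemma excluded_7:
  "list_all (\<lambda>z. list_all (\<lambda>(x, y). excluded x y z) (partners z)) [(7, 11), (7, 13), (7, 17), (7, 19)]"
  by (simp only: list.pred_inject prod.case partners_simps excluded.simps steps_simps moduli_def search_rewrites)

lemma excluded_11:
  "list_all (\<lambda>z. list_all (\<lambda>(x, y). excluded x y z) (partners z)) [(11, 13), (11, 17), (11, 19)]"
  by (simp only: list.pred_inject prod.case partners_simps excluded.simps steps_simps moduli_def search_rewrites)

lemma excluded_13:
  "list_all (\<lambda>z. list_all (\<lambda>(x, y). excluded x y z) (partners z)) [(13, 17), (13, 19)]"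
  by (simp only: list.pred_inject prod.case partners_simps excluded.simps steps_simps moduli_def search_rewrites)

lemma excluded_17:
  "list_all (\<lambda>z. list_all (\<lambda>(x, y). excluded x y z) (partners z)) [(17, 19)]"
  by (simp only: list.pred_inject prod.case partners_simps excluded.simps steps_simps moduli_def search_rewrites)


lemma excluded_partners:
  assumes "z \<in> set prime_pairs" "(x, y) \<in> set (partners z)"
  shows "excluded x y z"
proof -
  have "list_all (\<lambda>z. list_all (\<lambda>(x, y). excluded x y z) (partners z)) prime_pairs"
    using excluded_3 excluded_5 excluded_7 excluded_11 excluded_13 excluded_17
    by (simp add: prime_pairs_def odd_primes_def del: excluded.simps)
  then show ?thesis
    using assms by (auto simp: list_all_iff simp del: excluded.simps)
qed

section \<open>From increasing pairs to arbitrary distinct odd primes\<close>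

lemma sort_pair:
  fixes p p' :: int and a b :: nat
  assumes "p \<noteq> p'" "6 \<le> a" "6 \<le> b"
  obtains u c u' d where "u < u'" "{u, u'} = {p, p'}" "p ^ a * p' ^ b = u ^ c * u' ^ d" "6 \<le> c" "6 \<le> d"
proof (cases "p < p'")
  case True
  then show ?thesis
    using that[of p p' a b] assms by simp
next
  case False
  then show ?thesis
    using that[of p' p b a] assms by (simp add: insert_commute mult.commute)
qed

text \<open>The searches cover increasing pairs with the summands ordered by first prime.
  Commutativity within each term and between the two summands brings every equation to that
  form.\<close>

lemma no_solution_odd_primes:
  fixes p1 p2 p3 p4 p5 p6 :: int
  assumes "{p1, p2, p3, p4, p5, p6} \<subseteq> set odd_primes" "distinct [p1, p2, p3, p4, p5, p6]"
    and "6 \<le> a1" "6 \<le> a2" "6 \<le> a3" "6 \<le> a4" "6 \<le> a5" "6 \<le> a6"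
  shows "p1 ^ a1 * p2 ^ a2 + p3 ^ a3 * p4 ^ a4 \<noteq> p5 ^ a5 * p6 ^ a6 + 1"
proof -
  have sorted: "u ^ a * u' ^ b + v ^ c * v' ^ d \<noteq> w ^ e * w' ^ f + 1"
    if "{u, u', v, v', w, w'} \<subseteq> set odd_primes" "distinct [u, u', v, v', w, w']"
      "u < u'" "v < v'" "w < w'" "u < v" "6 \<le> a" "6 \<le> b" "6 \<le> c" "6 \<le> d" "6 \<le> e" "6 \<le> f"
    for u u' v v' w w' :: int and a b c d e f
  proof (rule excluded_sound)
    have pairs: "(u, u') \<in> set prime_pairs" "(v, v') \<in> set prime_pairs" "(w, w') \<in> set prime_pairs"
      using that by (auto simp: prime_pairs_def)
    then show "{(u, u'), (v, v'), (w, w')} \<subseteq> set prime_pairs"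
      by simp
    have "((u, u'), (v, v')) \<in> set (partners (w, w'))"
      using pairs that by (fastforce simp: partners_def)
    then show "excluded (u, u') (v, v') (w, w')"
      using excluded_partners pairs by blast
  qed (use that in auto)
  obtain u b1 u' b2 where u: "u < u'" "{u, u'} = {p1, p2}" "p1 ^ a1 * p2 ^ a2 = u ^ b1 * u' ^ b2" "6 \<le> b1" "6 \<le> b2"
    by (rule sort_pair[of p1 p2 a1 a2]) (use assms in auto)
  obtain v b3 v' b4 where v: "v < v'" "{v, v'} = {p3, p4}" "p3 ^ a3 * p4 ^ a4 = v ^ b3 * v' ^ b4" "6 \<le> b3" "6 \<le> b4"
    by (rule sort_pair[of p3 p4 a3 a4]) (use assms in auto)
  obtain w b5 w' b6 where w: "w < w'" "{w, w'} = {p5, p6}" "p5 ^ a5 * p6 ^ a6 = w ^ b5 * w' ^ b6" "6 \<le> b5" "6 \<le> b6"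
    by (rule sort_pair[of p5 p6 a5 a6]) (use assms in auto)
  have sub: "{u, u', v, v', w, w'} \<subseteq> set odd_primes"
    using assms(1) u(2) v(2) w(2) by blast
  have dist: "distinct [u, u', v, v', w, w']"
    using assms(2) u(2) v(2) w(2) by (auto simp: doubleton_eq_iff)
  show ?thesis
  proof (cases "u < v")
    case True
    then show ?thesis
      using sorted[of u u' v v' w w' b1 b2 b3 b4 b5 b6] u v w sub dist by simp
  next
    case False
    moreover have "u \<noteq> v"
      using dist by auto
    ultimately have "v < u"
      by linarith
    then have "v ^ b3 * v' ^ b4 + u ^ b1 * u' ^ b2 \<noteq> w ^ b5 * w' ^ b6 + 1"
      by (intro sorted) (use u v w sub dist in auto)
    then show ?thesis
      unfolding u(3) v(3) w(3) by (simp add: add.commute)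
  qed
qed

section \<open>Parity and the first claim\<close>

lemma prime_le_19:
  fixes n :: nat
  assumes "prime n" "n \<le> 19"
  shows "n \<in> {2, 3, 5, 7, 11, 13, 17, 19}"
proof -
  have "\<not> prime (4 :: nat)" "\<not> prime (6 :: nat)" "\<not> prime (8 :: nat)" "\<not> prime (9 :: nat)" "\<not> prime (10 :: nat)"
    "\<not> prime (12 :: nat)" "\<not> prime (14 :: nat)" "\<not> prime (15 :: nat)" "\<not> prime (16 :: nat)" "\<not> prime (18 :: nat)"
    by (simp_all add: prime_nat_numeral_eq)
  moreover have "n = 0 \<or> n = 1 \<or> n = 2 \<or> n = 3 \<or> n = 4 \<or> n = 5 \<or> n = 6 \<or> n = 7 \<or> n = 8 \<or> n = 9 \<or> n = 10
      \<or> n = 11 \<or> n = 12 \<or> n = 13 \<or> n = 14 \<or> n = 15 \<or> n = 16 \<or> n = 17 \<or> n = 18 \<or> n = 19"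
    using assms(2) by presburger
  ultimately show ?thesis
    using assms(1) by (elim disjE) auto
qed

theorem exponents_bounded:
  fixes p a :: "nat \<Rightarrow> nat"
  assumes inj: "inj_on p {1..6}" and primes: "\<forall>i\<in>{1..6}. prime (p i) \<and> p i \<le> 19"
    and eq: "int (p 1 ^ a 1 * p 2 ^ a 2) + int (p 3 ^ a 3 * p 4 ^ a 4) - int (p 5 ^ a 5 * p 6 ^ a 6) = 1"
  shows "Min (a ` {1..6}) \<le> 5"
proof (rule ccontr)
  assume "\<not> Min (a ` {1..6}) \<le> 5"
  then have gt: "\<forall>i \<in> {1..6}. 5 < a i"
    by (subst (asm) Min_le_iff) (auto simp: not_le)
  have a: "6 \<le> a i" if "i \<in> {1..6}" for i
  proof -
    from gt that have "5 < a i"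
      by (rule bspec)
    then show ?thesis
      by linarith
  qed
  have dist: "distinct [p 1, p 2, p 3, p 4, p 5, p 6]"
    by (simp add: inj_on_eq_iff[OF inj])
  have mem: "p i \<in> {2, 3, 5, 7, 11, 13, 17, 19}" if "i \<in> {1..6}" for i
    using prime_le_19 primes that by blast
  have ev: "even (p i) \<longleftrightarrow> p i = 2" if "i \<in> {1..6}" for i
    using mem[OF that] by auto
  \<comment> \<open>All exponents are positive, so a term is even exactly when 2 is one of its two
    primes.\<close>
  have "even (p 1 ^ a 1 * p 2 ^ a 2) \<longleftrightarrow> p 1 = 2 \<or> p 2 = 2" "even (p 3 ^ a 3 * p 4 ^ a 4) \<longleftrightarrow> p 3 = 2 \<or> p 4 = 2"
    "even (p 5 ^ a 5 * p 6 ^ a 6) \<longleftrightarrow> p 5 = 2 \<or> p 6 = 2"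
    using ev a[of 1] a[of 2] a[of 3] a[of 4] a[of 5] a[of 6] by auto
  moreover have "odd (p 1 ^ a 1 * p 2 ^ a 2 + p 3 ^ a 3 * p 4 ^ a 4 + p 5 ^ a 5 * p 6 ^ a 6)"
  proof -
    have "p 1 ^ a 1 * p 2 ^ a 2 + p 3 ^ a 3 * p 4 ^ a 4 = p 5 ^ a 5 * p 6 ^ a 6 + 1"
      using eq by linarith
    then show ?thesis
      by simp
  qed
  \<comment> \<open>The number of even terms is 0 or 2. As the primes are distinct, 2 divides at
    most one term, hence none.\<close>
  ultimately have "((p 1 = 2 \<or> p 2 = 2) \<longleftrightarrow> (p 3 = 2 \<or> p 4 = 2)) \<longleftrightarrow> \<not> (p 5 = 2 \<or> p 6 = 2)"
    by (simp only: even_add) argo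
  then have "p 1 \<noteq> 2 \<and> p 2 \<noteq> 2 \<and> p 3 \<noteq> 2 \<and> p 4 \<noteq> 2 \<and> p 5 \<noteq> 2 \<and> p 6 \<noteq> 2"
    using dist
    by (cases "p 1 = 2"; cases "p 2 = 2"; cases "p 3 = 2"; cases "p 4 = 2"; cases "p 5 = 2"; cases "p 6 = 2") simp_all
  moreover have "int (p i) \<in> set odd_primes" if "i \<in> {1..6}" "p i \<noteq> 2" for i
    using mem[OF that(1)] that(2) by (auto simp: odd_primes_def)
  ultimately have "{int (p 1), int (p 2), int (p 3), int (p 4), int (p 5), int (p 6)} \<subseteq> set odd_primes"
    by simp
  moreover have "distinct [int (p 1), int (p 2), int (p 3), int (p 4), int (p 5), int (p 6)]"
    using dist by simp
  ultimately have "int (p 1) ^ a 1 * int (p 2) ^ a 2 + int (p 3) ^ a 3 * int (p 4) ^ a 4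
      \<noteq> int (p 5) ^ a 5 * int (p 6) ^ a 6 + 1"
    by (rule no_solution_odd_primes) (use a in auto)
  then show False
    using eq by simp
qed

section \<open>The equation in the primes up to 13\<close>

text \<open>Unlike in \<open>excluded\<close>, each term comes with its own starting class, lattice
  and divisor. The lattice \<open>(0, 0, 1)\<close> pins the first exponent to its starting value,
  which lets a fixed power enter the search as a term.\<close>

lemma refutation:
  assumes "valid dx p1 p2 Hx qs cx" "(int a1 - v1, int a2 - v2) \<in> lattice Hx" "dx dvd p1 ^ a1 * p2 ^ a2"
    and "valid dy p3 p4 Hy qs cy" "(int a3 - v3, int a4 - v4) \<in> lattice Hy" "dy dvd p3 ^ a3 * p4 ^ a4"
    and "valid dz p5 p6 Hz qs cz" "(int a5 - v5, int a6 - v6) \<in> lattice Hz" "dz dvd p5 ^ a5 * p6 ^ a6"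
    and "exhausts (search qs (compile p1 p2 qs cx) (compile p3 p4 qs cy) (compile p5 p6 qs cz))
      (digits_of v1 v2) (digits_of v3 v4) (digits_of v5 v6)"
  shows "p1 ^ a1 * p2 ^ a2 + p3 ^ a3 * p4 ^ a4 \<noteq> p5 ^ a5 * p6 ^ a6 + 1"
  by (rule exhausts_sound[OF assms(10) valid_feasible[OF assms(1-3)] valid_feasible[OF assms(4-6)]
        valid_feasible[OF assms(7-9)]])

section \<open>Searches for a fixed or a large power of 3\<close>

lemmas compile_rewrites = digits_of_def log_vector_def Let_def upto.simps

text \<open>The factor \<open>1 ^ 0\<close> brings a single prime power into the two-base form of
  the certificates. For the constant first term every refinement is trivial, of index 1. As
  \<open>c\<close> is positive, the second term vanishes modulo 5.\<close>

lemma no_solution_b_1: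
  assumes "1 \<le> c"
  shows "(3::int) ^ 1 * 1 ^ 0 + 5 ^ c * 7 ^ d \<noteq> 11 ^ e * 13 ^ f + 1"
proof -
  let ?qs = "[5, 4, 8, 16, 61, 41, 181] :: int list"
  let ?x = "[Refine 1 0 0 0 0 1 0 0, Refine 1 0 0 0 0 1 0 0, Refine 1 0 0 0 0 1 0 0,
       Refine 1 0 0 0 0 1 0 0, Refine 1 0 0 0 0 1 0 0, Refine 1 0 0 0 0 1 0 0,
       Refine 1 0 0 0 0 1 0 0]"
  let ?y = "[Vanish, Refine 2 0 1 1 0 2 0 1, Refine 2 1 0 2 0 2 1 0, Refine 2 2 0 4 0 2 1 0,
       Refine 30 0 2 60 32 4 26 1, Refine 2 32 4 60 4 8 0 1, Refine 15 4 8 60 0 120 0 1]"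
  let ?z = "[Refine 4 0 1 1 0 4 0 1, Refine 2 1 0 2 0 4 1 0, Refine 1 0 0 2 0 4 0 0,
       Refine 2 2 0 4 0 4 1 0, Refine 3 0 4 4 0 12 0 1, Refine 10 0 12 40 36 12 1 1,
       Refine 9 40 0 360 276 12 1 3]"
  have x: "valid 1 3 1 (0, 0, 1) ?qs ?x" and y: "valid 5 5 7 (1, 0, 1) ?qs ?y"
    and z: "valid 1 11 13 (1, 0, 1) ?qs ?z"
    by (simp_all add: ok_refine_def)
  have "exhausts (search ?qs (compile 3 1 ?qs ?x) (compile 5 7 ?qs ?y) (compile 11 13 ?qs ?z))
    (digits_of 1 0) (digits_of 0 0) (digits_of 0 0)"
    by (simp add: compile_rewrites, simp only: search_rewrites)
  moreover have "1 dvd (3::int) ^ 1 * 1 ^ 0" "5 dvd (5::int) ^ c * 7 ^ d"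
    using assms le_imp_power_dvd[of 1 c "5::int"] by simp_all
  ultimately show ?thesis
    by (intro refutation[OF x _ _ y _ _ z]) (simp_all add: lattice_def)
qed

text \<open>By hand: \<open>11 ^ e * 13 ^ f\<close> would be 8 modulo 35. Modulo 5 this reads
  \<open>3 ^ f = 3\<close>, so \<open>f\<close> is odd; modulo 7 it then says that
  \<open>4 ^ e\<close> is -1, but the powers of 4 modulo 7 are 1, 4 and 2.\<close>

lemma no_solution_b_2_d_pos:
  assumes "1 \<le> c" "1 \<le> d"
  shows "(3::int) ^ 2 * 1 ^ 0 + 5 ^ c * 7 ^ d \<noteq> 11 ^ e * 13 ^ f + 1"
proof -
  let ?qs = "[5, 7] :: int list"
  let ?x = "[Refine 1 0 0 0 0 1 0 0, Refine 1 0 0 0 0 1 0 0]"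
  let ?y = "[Vanish, Vanish]"
  let ?z = "[Refine 4 0 1 1 0 4 0 1, Refine 3 1 0 3 0 4 1 0]"
  have x: "valid 1 3 1 (0, 0, 1) ?qs ?x" and y: "valid 35 5 7 (1, 0, 1) ?qs ?y"
    and z: "valid 1 11 13 (1, 0, 1) ?qs ?z"
    by (simp_all add: ok_refine_def)
  have "exhausts (search ?qs (compile 3 1 ?qs ?x) (compile 5 7 ?qs ?y) (compile 11 13 ?qs ?z))
    (digits_of 2 0) (digits_of 0 0) (digits_of 0 0)"
    by (simp add: compile_rewrites, simp only: search_rewrites)
  moreover have "1 dvd (3::int) ^ 2 * 1 ^ 0" "35 dvd (5::int) ^ c * 7 ^ d"
    using assms mult_dvd_mono[OF le_imp_power_dvd[of 1 c "5::int"] le_imp_power_dvd[of 1 d "7::int"]] by simp_all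
  ultimately show ?thesis
    by (intro refutation[OF x _ _ y _ _ z]) (simp_all add: lattice_def)
qed

text \<open>The bound on \<open>c\<close> acts through the modulus 25: the genuine solution
  \<open>9 + 5 = 13 + 1\<close> passes every other modulus of the list.\<close>

lemma no_solution_b_2_d_0:
  assumes "2 \<le> c"
  shows "(3::int) ^ 2 * 1 ^ 0 + 5 ^ c * 1 ^ 0 \<noteq> 11 ^ e * 13 ^ f + 1"
proof -
  let ?qs = "[4, 5, 25, 8, 7, 19, 37, 16, 73, 32, 17, 181, 241] :: int list"
  let ?x = "[Refine 1 0 0 0 0 1 0 0, Refine 1 0 0 0 0 1 0 0, Refine 1 0 0 0 0 1 0 0,
       Refine 1 0 0 0 0 1 0 0, Refine 1 0 0 0 0 1 0 0, Refine 1 0 0 0 0 1 0 0,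
       Refine 1 0 0 0 0 1 0 0, Refine 1 0 0 0 0 1 0 0, Refine 1 0 0 0 0 1 0 0,
       Refine 1 0 0 0 0 1 0 0, Refine 1 0 0 0 0 1 0 0, Refine 1 0 0 0 0 1 0 0,
       Refine 1 0 0 0 0 1 0 0]"
  let ?y = "[Refine 1 0 0 1 0 1 0 0, Vanish, Vanish, Refine 2 1 0 2 0 1 1 0, Refine 3 2 0 6 0 1 1 0,
       Refine 3 6 0 18 0 1 1 0, Refine 2 18 0 36 0 1 1 0, Refine 1 0 0 36 0 1 0 0,
       Refine 2 36 0 72 0 1 1 0, Refine 1 0 0 72 0 1 0 0, Refine 2 72 0 144 0 1 1 0,
       Refine 5 144 0 720 0 1 1 0, Refine 1 0 0 720 0 1 0 0]"
  let ?z = "[Refine 2 1 0 2 0 1 1 0, Refine 4 0 1 2 0 4 0 1, Refine 5 0 4 10 4 4 2 1,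
       Refine 1 0 0 10 4 4 0 0, Refine 3 4 4 30 24 4 1 1, Refine 9 24 4 30 6 36 0 1,
       Refine 1 0 0 30 6 36 0 0, Refine 2 6 36 60 36 36 1 1, Refine 6 60 0 360 36 36 1 0,
       Refine 1 0 0 360 36 36 0 0, Refine 4 36 36 720 432 72 2 1, Refine 5 432 72 720 0 360 0 1,
       Refine 2 0 360 720 0 720 0 1]"
  have x: "valid 1 3 1 (0, 0, 1) ?qs ?x" and y: "valid 25 5 1 (1, 0, 1) ?qs ?y"
    and z: "valid 1 11 13 (1, 0, 1) ?qs ?z"
    by (simp_all add: ok_refine_def)
  have "exhausts (search ?qs (compile 3 1 ?qs ?x) (compile 5 1 ?qs ?y) (compile 11 13 ?qs ?z))
    (digits_of 2 0) (digits_of 0 0) (digits_of 0 0)"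
    by (simp add: compile_rewrites, simp only: search_rewrites)
  moreover have "1 dvd (3::int) ^ 2 * 1 ^ 0" "25 dvd (5::int) ^ c * 1 ^ 0"
    using assms le_imp_power_dvd[of 2 c "5::int"] by simp_all
  ultimately show ?thesis
    by (intro refutation[OF x _ _ y _ _ z]) (simp_all add: lattice_def)
qed

text \<open>Here the modulus 27 separates the case from \<open>9 + 5 = 13 + 1\<close>, whose first
  term also vanishes modulo 3 and 9.\<close>

lemma no_solution_b_3_d_0:
  assumes "3 \<le> b" "1 \<le> c"
  shows "(3::int) ^ b * 1 ^ 0 + 5 ^ c * 1 ^ 0 \<noteq> 11 ^ e * 13 ^ f + 1"
proof -
  let ?qs = "[3, 4, 8, 5, 16, 9, 7, 61, 241, 41, 32, 73, 27] :: int list"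
  let ?x = "[Vanish, Refine 2 1 0 2 0 1 1 0, Refine 1 0 0 2 0 1 0 0, Refine 2 2 0 4 0 1 1 0,
       Refine 1 0 0 4 0 1 0 0, Vanish, Refine 3 4 0 12 0 1 1 0, Refine 5 12 0 60 0 1 1 0,
       Refine 2 60 0 120 0 1 1 0, Refine 1 0 0 120 0 1 0 0, Refine 1 0 0 120 0 1 0 0,
       Refine 1 0 0 120 0 1 0 0, Vanish]"
  let ?y = "[Refine 2 1 0 2 0 1 1 0, Refine 1 0 0 2 0 1 0 0, Refine 1 0 0 2 0 1 0 0, Vanish,
       Refine 2 2 0 4 0 1 1 0, Refine 3 4 0 12 0 1 1 0, Refine 1 0 0 12 0 1 0 0,
       Refine 5 12 0 60 0 1 1 0, Refine 2 60 0 120 0 1 1 0, Refine 1 0 0 120 0 1 0 0,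
       Refine 1 0 0 120 0 1 0 0, Refine 3 120 0 360 0 1 1 0, Refine 1 0 0 360 0 1 0 0]"
  let ?z = "[Refine 2 1 0 2 0 1 1 0, Refine 1 0 0 2 0 1 0 0, Refine 2 0 1 2 0 2 0 1,
       Refine 2 0 2 2 0 4 0 1, Refine 2 2 0 4 0 4 1 0, Refine 3 0 4 12 4 4 2 1,
       Refine 3 4 4 12 0 12 0 1, Refine 1 0 0 12 0 12 0 0, Refine 20 0 12 48 12 60 15 1,
       Refine 5 12 60 240 60 60 4 1, Refine 1 0 0 240 60 60 0 0, Refine 3 240 0 720 60 60 1 0,
       Refine 1 0 0 720 60 60 0 0]"
  have x: "valid 27 3 1 (1, 0, 1) ?qs ?x" and y: "valid 5 5 1 (1, 0, 1) ?qs ?y"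
    and z: "valid 1 11 13 (1, 0, 1) ?qs ?z"
    by (simp_all add: ok_refine_def)
  have "exhausts (search ?qs (compile 3 1 ?qs ?x) (compile 5 1 ?qs ?y) (compile 11 13 ?qs ?z))
    (digits_of 0 0) (digits_of 0 0) (digits_of 0 0)"
    by (simp add: compile_rewrites, simp only: search_rewrites)
  moreover have "27 dvd (3::int) ^ b * 1 ^ 0" "5 dvd (5::int) ^ c * 1 ^ 0"
    using assms le_imp_power_dvd[of 3 b "3::int"] le_imp_power_dvd[of 1 c "5::int"] by simp_all
  ultimately show ?thesis
    by (intro refutation[OF x _ _ y _ _ z]) (simp_all add: lattice_def)
qed

text \<open>The first term vanishes modulo 3, 9 and 27, the second modulo 5 and 7; the term in 11
  and 13 is a unit for all moduli used.\<close>

lemma no_solution_b_3_d_pos: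
  assumes "3 \<le> b" "1 \<le> c" "1 \<le> d"
  shows "(3::int) ^ b * 1 ^ 0 + 5 ^ c * 7 ^ d \<noteq> 11 ^ e * 13 ^ f + 1"
proof -
  let ?qs = "[3, 4, 8, 5, 7, 16, 9, 37, 19, 73, 27, 61, 181, 41] :: int list"
  let ?x = "[Vanish, Refine 2 1 0 2 0 1 1 0, Refine 1 0 0 2 0 1 0 0, Refine 2 2 0 4 0 1 1 0,
       Refine 3 4 0 12 0 1 1 0, Refine 1 0 0 12 0 1 0 0, Vanish, Refine 3 12 0 36 0 1 1 0,
       Refine 1 0 0 36 0 1 0 0, Refine 1 0 0 36 0 1 0 0, Vanish, Refine 5 36 0 180 0 1 1 0,
       Refine 1 0 0 180 0 1 0 0, Refine 2 180 0 360 0 1 1 0]"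
  let ?y = "[Refine 2 1 0 2 0 1 1 0, Refine 2 0 1 2 0 2 0 1, Refine 1 0 0 2 0 2 0 0, Vanish, Vanish,
       Refine 2 2 0 4 0 2 1 0, Refine 3 0 2 12 8 2 1 1, Refine 9 8 2 36 12 6 3 1,
       Refine 3 12 6 36 0 18 0 1, Refine 4 0 18 72 36 36 2 1, Refine 1 0 0 72 36 36 0 0,
       Refine 5 36 36 360 108 36 4 1, Refine 5 108 36 360 180 180 0 1,
       Refine 2 180 180 360 0 360 0 1]"
  let ?z = "[Refine 2 1 0 2 0 1 1 0, Refine 1 0 0 2 0 1 0 0, Refine 2 0 1 2 0 2 0 1,
       Refine 2 0 2 2 0 4 0 1, Refine 3 2 0 6 0 4 1 0, Refine 2 6 0 12 0 4 1 0,
       Refine 3 0 4 12 0 12 0 1, Refine 3 0 12 12 0 36 0 1, Refine 1 0 0 12 0 36 0 0,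
       Refine 6 12 0 72 36 36 1 3, Refine 1 0 0 72 36 36 0 0, Refine 1 0 0 72 36 36 0 0,
       Refine 5 36 36 360 108 36 4 1, Refine 1 0 0 360 108 36 0 0]"
  have x: "valid 27 3 1 (1, 0, 1) ?qs ?x" and y: "valid 35 5 7 (1, 0, 1) ?qs ?y"
    and z: "valid 1 11 13 (1, 0, 1) ?qs ?z"
    by (simp_all add: ok_refine_def)
  have "exhausts (search ?qs (compile 3 1 ?qs ?x) (compile 5 7 ?qs ?y) (compile 11 13 ?qs ?z))
    (digits_of 0 0) (digits_of 0 0) (digits_of 0 0)"
    by (simp add: compile_rewrites, simp only: search_rewrites)
  moreover have "27 dvd (3::int) ^ b * 1 ^ 0" "35 dvd (5::int) ^ c * 7 ^ d"
    using assms le_imp_power_dvd[of 3 b "3::int"] mult_dvd_mono[OF le_imp_power_dvd[of 1 c "5::int"] le_imp_power_dvd[of 1 d "7::int"]] by simp_all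
  ultimately show ?thesis
    by (intro refutation[OF x _ _ y _ _ z]) (simp_all add: lattice_def)
qed

section \<open>Case distinction for the second equation\<close>

lemma prime_not_dvd_power_product:
  fixes r x y :: int
  assumes "prime r" "\<not> r dvd x" "\<not> r dvd y"
  shows "\<not> r dvd x ^ m * y ^ n"
  using assms by (meson prime_dvd_mult_iff prime_dvd_power)

text \<open>For \<open>b = 0\<close> the two sides of \<open>5 ^ c * 7 ^ d = 11 ^ e * 13 ^ f\<close>
  share no prime factor, so all exponents vanish. For positive \<open>b\<close>, reduction modulo 3
  makes \<open>c\<close> positive, the searches leave only \<open>b = 2\<close>,
  \<open>d = 0\<close>, \<open>c = 1\<close>, and \<open>11 ^ e * 13 ^ f = 13\<close>
  remains.\<close>

lemma equation_solutions:
  fixes b c d e f :: nat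
  assumes eq: "(3::int) ^ b + 5 ^ c * 7 ^ d = 11 ^ e * 13 ^ f + 1"
  shows "(b, c, d, e, f) \<in> {(0, 0, 0, 0, 0), (2, 1, 0, 0, 1)}"
proof (cases "b = 0")
  case True
  then have eq0: "(5::int) ^ c * 7 ^ d = 11 ^ e * 13 ^ f"
    using eq by simp
  have "\<not> (5::int) dvd 11 ^ e * 13 ^ f" "\<not> (7::int) dvd 11 ^ e * 13 ^ f"
    by (simp_all add: prime_not_dvd_power_product)
  then have "c = 0" "d = 0"
    unfolding eq0[symmetric] by (auto intro: ccontr)
  then have "(11::int) ^ e * 13 ^ f = 1"
    using eq0 by simp
  then have "(11::int) ^ e dvd 1" "(13::int) ^ f dvd 1"
    by (metis dvd_triv_left, metis dvd_triv_right)
  then have "e = 0" "f = 0"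
    by (auto simp: is_unit_power_iff)
  then show ?thesis
    using True \<open>c = 0\<close> \<open>d = 0\<close> by simp
next
  case False
  have "1 \<le> c"
  proof (rule ccontr)
    assume "\<not> 1 \<le> c"
    then have "c = 0"
      by simp
    \<comment> \<open>Since 7 is 1 modulo 3 and \<open>b\<close> is positive, the right-hand side is
      divisible by 3, but \<open>11 ^ e * 13 ^ f\<close> is not.\<close>
    then have "(11::int) ^ e * 13 ^ f = 3 ^ b + (7 ^ d - 1)"
      using eq by simp
    moreover have "(3::int) dvd 3 ^ b" "(3::int) dvd 7 ^ d - 1"
      using False cong_pow[of 7 1 "3::int" d] by (auto simp: cong_iff_dvd_diff)
    ultimately have "(3::int) dvd 11 ^ e * 13 ^ f"
      by simp
    then show False
      by (simp add: prime_not_dvd_power_product)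
  qed
  then have "b \<noteq> 1"
    using no_solution_b_1[of c d e f] eq by auto
  have "\<not> 3 \<le> b"
    using no_solution_b_3_d_0[of b c e f] no_solution_b_3_d_pos[of b c d e f] \<open>1 \<le> c\<close> eq
    by (cases "d = 0") auto
  then have "b = 2"
    using False \<open>b \<noteq> 1\<close> by simp
  then have "d = 0"
    using no_solution_b_2_d_pos[of c d e f] \<open>1 \<le> c\<close> eq by (cases "d = 0") auto
  then have "c = 1"
    using no_solution_b_2_d_0[of c e f] \<open>1 \<le> c\<close> \<open>b = 2\<close> eq by (cases "2 \<le> c") auto
  have eq13: "(11::int) ^ e * 13 ^ f = 13"
    using eq \<open>b = 2\<close> \<open>c = 1\<close> \<open>d = 0\<close> by simp
  have "e = 0"
  proof (rule ccontr)
    assume "e \<noteq> 0"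
    then have "(11::int) dvd 11 ^ e * 13 ^ f"
      by simp
    then show False
      unfolding eq13 by simp
  qed
  then have "(13::int) ^ f = 13 ^ 1"
    using eq13 by simp
  then have "f = 1"
    by (simp only: power_inject_exp)
  with \<open>b = 2\<close> \<open>c = 1\<close> \<open>d = 0\<close> \<open>e = 0\<close> show ?thesis
    by simp
qed

theorem theorem6:
  shows "(\<forall>p :: nat \<Rightarrow> nat. \<forall>a :: nat \<Rightarrow> nat.
            inj_on p {1..6} \<and> (\<forall>i\<in>{1..6}. prime (p i) \<and> p i \<le> 19) \<and>
            int (p 1 ^ a 1 * p 2 ^ a 2) + int (p 3 ^ a 3 * p 4 ^ a 4)
              - int (p 5 ^ a 5 * p 6 ^ a 6) = 1
            \<longrightarrow> Min (a ` {1..6}) \<le> 5)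
       \<and> {(a1::nat, a2::nat, a3::nat, a4::nat, a5::nat, a6::nat).
            (2::int) ^ a1 * 3 ^ a2 + 5 ^ a3 * 7 ^ a4 - 11 ^ a5 * 13 ^ a6 = 1}
         = {(0, 0, 0, 0, 0, 0), (0, 2, 1, 0, 0, 1)}"
proof (rule conjI)
  have *: "(a1, a2, a3, a4, a5, a6) \<in> {(0, 0, 0, 0, 0, 0), (0, 2, 1, 0, 0, 1)}"
    if eq: "(2::int) ^ a1 * 3 ^ a2 + 5 ^ a3 * 7 ^ a4 - 11 ^ a5 * 13 ^ a6 = 1" for a1 a2 a3 a4 a5 a6 :: nat
  proof -
    have "odd ((2::int) ^ a1 * 3 ^ a2 + 5 ^ a3 * 7 ^ a4 - 11 ^ a5 * 13 ^ a6)"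
      using eq by simp
    \<comment> \<open>For positive \<open>a1\<close> the first term is even and the other two are
      odd, so the left-hand side would be even.\<close>
    then have "a1 = 0"
      by (auto intro: ccontr)
    then show ?thesis
      using equation_solutions[of a2 a3 a4 a5 a6] eq by simp
  qed
  show "{(a1::nat, a2::nat, a3::nat, a4::nat, a5::nat, a6::nat).
            (2::int) ^ a1 * 3 ^ a2 + 5 ^ a3 * 7 ^ a4 - 11 ^ a5 * 13 ^ a6 = 1}
         = {(0, 0, 0, 0, 0, 0), (0, 2, 1, 0, 0, 1)}"
    (is "?L = ?R")
  proof (intro equalityI subsetI)
    fix x
    assume "x \<in> ?L"
    then obtain a1 a2 a3 a4 a5 a6 where "x = (a1, a2, a3, a4, a5, a6)"
      "(2::int) ^ a1 * 3 ^ a2 + 5 ^ a3 * 7 ^ a4 - 11 ^ a5 * 13 ^ a6 = 1"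
      by blast
    then show "x \<in> ?R"
      using * by metis
  qed auto
qed (use exponents_bounded in blast)

end
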